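(* Let $\mathfrak g_0$ be a finite-dimensional simple Lie algebra of simply-laced type with Cartan matrix $(a_{ij})_{i,j\in I_0}$. The braid group $B(\mathfrak g_0)$ acts (by $\mathbb C(t^{1/2})$-algebra automorphisms) on the algebra $\mathbb K_t(\mathfrak g_0)$ by the following formulas, for $i,j\in I_0$ and $m\in\mathbb Z$: $$\sigma_i(y_{j,m})=\begin{cases} y_{j,m+\delta_{ij}} & \text{if } a_{ij}\neq -1,\\[1ex] \dfrac{t^{1/2}y_{j,m}y_{i,m}-t^{-1/2}y_{i,m}y_{j,m}}{t-t^{-1}} & \text{if } a_{ij}=-1,\end{cases}$$ $$\sigma_i^{-1}(y_{j,m})=\begin{cases} y_{j,m-\delta_{ij}} & \text{if } a_{ij}\neq -1,\\[1ex] \dfrac{t^{1/2}y_{i,m}y_{j,m}-t^{-1/2}y_{j,m}y_{i,m}}{t-t^{-1}} & \text{if } a_{ij}=-1.\end{cases}$$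
   Context: $\mathbb K_t(\mathfrak g_0)$ is the associative unital $\mathbb C(t^{1/2})$-algebra ($t$ an indeterminate) generated by $\{y_{i,m}\mid i\in I_0,\ m\in\mathbb Z\}$ with the defining relations: (a) for $m\in\mathbb Z$: $y_{i,m}y_{j,m}=y_{j,m}y_{i,m}$ if $a_{ij}=0$, and $y_{i,m}^2y_{j,m}-(t+t^{-1})y_{i,m}y_{j,m}y_{i,m}+y_{j,m}y_{i,m}^2=0$ if $a_{ij}=-1$; (b) for $m\in\mathbb Z$ and $i,j\in I_0$: $y_{i,m}y_{j,m+1}=t^{a_{ij}}y_{j,m+1}y_{i,m}+\delta_{ij}(1-t^2)$; (c) for $p>m+1$ and $i,j\in I_0$: $y_{i,m}y_{j,p}=t^{(-1)^{p-m+1}a_{ij}}y_{j,p}y_{i,m}$. (This algebra is isomorphic to the quantum Grothendieck ring of the Hernandez-Leclerc category $\mathscr C^0_{\mathfrak g}$ of the untwisted quantum affine algebra attached to $\mathfrak g_0$.) $B(\mathfrak g_0)$ is the group generated by $\{\sigma_i\mid i\in I_0\}$ with defining relations $\sigma_i\sigma_j\sigma_i=\sigma_j\sigma_i\sigma_j$ if $a_{ij}=-1$, and $\sigma_i\sigma_j=\sigma_j\sigma_i$ if $a_{ij}=0$. *)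

theory Defs
  imports
    "HOL-Library.Poly_Mapping"
    "HOL-Computational_Algebra.Computational_Algebra"
    "HOL-Algebra.Algebra"
begin

section \<open>Cartan matrices of finite simply-laced type\<close>

text \<open>
  The index set \<open>I\<^sub>0\<close> is the finite type \<open>'i\<close>.  The matrices below are exactly the Cartan matrices of
  finite-dimensional simple complex Lie algebras (Killing--Cartan--Serre): indecomposable generalized
  Cartan matrices that become symmetric positive definite after multiplication from the left by a
  positive diagonal matrix.
\<close>

definition generalized_cartan_matrix :: "('i \<Rightarrow> 'i \<Rightarrow> int) \<Rightarrow> bool" where
  "generalized_cartan_matrix a \<longleftrightarrow>
     (\<forall>i. a i i = 2) \<and> (\<forall>i j. i \<noteq> j \<longrightarrow> a i j \<le> 0) \<and> (\<forall>i j. a i j = 0 \<longleftrightarrow> a j i = 0)"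

definition finite_type :: "('i::finite \<Rightarrow> 'i \<Rightarrow> int) \<Rightarrow> bool" where
  "finite_type a \<longleftrightarrow>
     (\<exists>d :: 'i \<Rightarrow> real.
        (\<forall>i. d i > 0) \<and>
        (\<forall>i j. d i * of_int (a i j) = d j * of_int (a j i)) \<and>
        (\<forall>x :: 'i \<Rightarrow> real. (\<exists>i. x i \<noteq> 0) \<longrightarrow>
           (\<Sum>i\<in>UNIV. \<Sum>j\<in>UNIV. d i * of_int (a i j) * x i * x j) > 0))"

definition indecomposable :: "('i \<Rightarrow> 'i \<Rightarrow> int) \<Rightarrow> bool" where
  "indecomposable a \<longleftrightarrow>
     (\<forall>J. J \<noteq> {} \<and> J \<noteq> UNIV \<longrightarrow> (\<exists>i\<in>J. \<exists>j\<in>-J. a i j \<noteq> 0))"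

definition simply_laced :: "('i \<Rightarrow> 'i \<Rightarrow> int) \<Rightarrow> bool" where
  "simply_laced a \<longleftrightarrow> (\<forall>i j. i \<noteq> j \<longrightarrow> a i j = 0 \<or> a i j = -1)"

definition simple_simply_laced_cartan_matrix :: "('i::finite \<Rightarrow> 'i \<Rightarrow> int) \<Rightarrow> bool" where
  "simple_simply_laced_cartan_matrix a \<longleftrightarrow>
     generalized_cartan_matrix a \<and> finite_type a \<and> indecomposable a \<and> simply_laced a"


section \<open>The base field\<close>

text \<open>\<open>\<complex>(t\<^sup>1\<^sup>/\<^sup>2)\<close> is the field of rational functions in the indeterminate \<open>t_half\<close>.\<close>

type_synonym base_field = "complex poly fract"

definition t_half :: base_field where
  "t_half = Fract [:0, 1:] 1"

definition t_indet :: base_field where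
  "t_indet = t_half ^ 2"


section \<open>Free algebras and algebras given by generators and relations\<close>

datatype 'x fword = FWord "'x list"

instantiation fword :: (type) monoid_add
begin

definition zero_fword :: "'x fword" where
  "zero_fword = FWord []"

fun plus_fword :: "'x fword \<Rightarrow> 'x fword \<Rightarrow> 'x fword" where
  "plus_fword (FWord u) (FWord v) = FWord (u @ v)"

instance
proof
  fix u v w :: "'x fword"
  show "u + v + w = u + (v + w)" by (cases u; cases v; cases w) simp
  show "0 + u = u" "u + 0 = u" by (cases u; simp add: zero_fword_def)+
qed

end

text \<open>
  The free associative unital \<open>'k\<close>-algebra on \<open>'x\<close> is the monoid algebra of the free monoid (words
  under concatenation, written additively as \<^theory>\<open>HOL-Library.Poly_Mapping\<close> requires); its ring
  operations are those of the type class.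
\<close>

type_synonym ('x, 'k) free_algebra = "'x fword \<Rightarrow>\<^sub>0 'k"

definition free_gen :: "'x \<Rightarrow> ('x, 'k::field) free_algebra" where
  "free_gen x = Poly_Mapping.single (FWord [x]) 1"

definition free_const :: "'k::field \<Rightarrow> ('x, 'k) free_algebra" where
  "free_const c = Poly_Mapping.single 0 c"

definition free_ring :: "('x, 'k::field) free_algebra ring" where
  "free_ring = \<lparr>carrier = UNIV, monoid.mult = (*), one = 1, ring.zero = 0, ring.add = (+)\<rparr>"

text \<open>
  The relators \<open>S\<close> are set to zero: quotient by the two-sided ideal they generate.  Algebras are
  \<^typ>\<open>('k, 'v) module\<close> records, combining ring operations with a scalar multiplication.
\<close>

definition presented_algebra ::
    "('x, 'k::field) free_algebra set \<Rightarrow> ('k, ('x, 'k) free_algebra set) module" where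
  "presented_algebra S =
    (let I = Idl\<^bsub>free_ring\<^esub> S; Q = free_ring Quot I in
      \<lparr>carrier = carrier Q, monoid.mult = monoid.mult Q, one = one Q,
       ring.zero = ring.zero Q, ring.add = ring.add Q,
       smult = (\<lambda>c U. (I +>\<^bsub>free_ring\<^esub> free_const c) \<otimes>\<^bsub>Q\<^esub> U)\<rparr>)"

definition presented_algebra_gen ::
    "('x, 'k::field) free_algebra set \<Rightarrow> 'x \<Rightarrow> ('x, 'k) free_algebra set" where
  "presented_algebra_gen S x = (Idl\<^bsub>free_ring\<^esub> S) +>\<^bsub>free_ring\<^esub> free_gen x"

definition algebra_automorphisms :: "('k, 'v) module \<Rightarrow> ('v \<Rightarrow> 'v) set" where
  "algebra_automorphisms A =
     {f \<in> ring_iso A A. \<forall>c. \<forall>x\<in>carrier A. f (c \<odot>\<^bsub>A\<^esub> x) = c \<odot>\<^bsub>A\<^esub> f x}"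


section \<open>The algebra \<open>\<bbbK>\<^sub>t(\<gg>\<^sub>0)\<close>\<close>

definition Y :: "'i \<Rightarrow> int \<Rightarrow> ('i \<times> int, base_field) free_algebra" where
  "Y i m = free_gen (i, m)"

definition Kt_relators ::
    "('i \<Rightarrow> 'i \<Rightarrow> int) \<Rightarrow> ('i \<times> int, base_field) free_algebra set" where
  "Kt_relators a =
     {Y i m * Y j m - Y j m * Y i m | i j m. a i j = 0} \<union>
     {Y i m ^ 2 * Y j m - free_const (t_indet + inverse t_indet) * (Y i m * Y j m * Y i m) + Y j m * Y i m ^ 2
        | i j m. a i j = -1} \<union>
     {Y i m * Y j (m + 1) -
        (free_const (t_indet powi a i j) * (Y j (m + 1) * Y i m) + free_const (of_bool (i = j) * (1 - t_indet ^ 2)))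
        | i j m. True} \<union>
     {Y i m * Y j p - free_const (t_indet powi ((-1) ^ nat (p - m + 1) * a i j)) * (Y j p * Y i m)
        | i j m p. p > m + 1}"

definition Kt :: "('i \<Rightarrow> 'i \<Rightarrow> int) \<Rightarrow> (base_field, ('i \<times> int, base_field) free_algebra set) module" where
  "Kt a = presented_algebra (Kt_relators a)"

definition y_gen :: "('i \<Rightarrow> 'i \<Rightarrow> int) \<Rightarrow> 'i \<Rightarrow> int \<Rightarrow> ('i \<times> int, base_field) free_algebra set" where
  "y_gen a i m = presented_algebra_gen (Kt_relators a) (i, m)"


section \<open>Groups given by generators and relations, and the braid group\<close>

text \<open>
  A group word is a list of letters; \<open>(x, True)\<close> is the generator \<open>x\<close> and \<open>(x, False)\<close> its formal
  inverse.  A pair \<open>(u, v)\<close> in \<open>R\<close> stands for the relation \<open>u = v\<close>.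
\<close>

inductive word_equiv :: "(('x \<times> bool) list \<times> ('x \<times> bool) list) set \<Rightarrow>
    ('x \<times> bool) list \<Rightarrow> ('x \<times> bool) list \<Rightarrow> bool"
  for R where
  relation: "(u, v) \<in> R \<Longrightarrow> word_equiv R u v"
| cancel: "word_equiv R [(x, b), (x, \<not> b)] []"
| refl: "word_equiv R u u"
| sym: "word_equiv R u v \<Longrightarrow> word_equiv R v u"
| trans: "word_equiv R u v \<Longrightarrow> word_equiv R v w \<Longrightarrow> word_equiv R u w"
| append: "word_equiv R u u' \<Longrightarrow> word_equiv R v v' \<Longrightarrow> word_equiv R (u @ v) (u' @ v')"

definition word_class :: "(('x \<times> bool) list \<times> ('x \<times> bool) list) set \<Rightarrow>
    ('x \<times> bool) list \<Rightarrow> ('x \<times> bool) list set" where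
  "word_class R u = {v. word_equiv R u v}"

definition presented_group :: "(('x \<times> bool) list \<times> ('x \<times> bool) list) set \<Rightarrow>
    ('x \<times> bool) list set monoid" where
  "presented_group R =
     \<lparr>carrier = range (word_class R),
      monoid.mult = (\<lambda>U Z. \<Union>u\<in>U. \<Union>v\<in>Z. word_class R (u @ v)),
      one = word_class R []\<rparr>"

definition braid_relations ::
    "('i \<Rightarrow> 'i \<Rightarrow> int) \<Rightarrow> (('i \<times> bool) list \<times> ('i \<times> bool) list) set" where
  "braid_relations a =
     {([(i, True), (j, True), (i, True)], [(j, True), (i, True), (j, True)]) | i j. a i j = -1} \<union>
     {([(i, True), (j, True)], [(j, True), (i, True)]) | i j. a i j = 0}"

definition braid_group :: "('i \<Rightarrow> 'i \<Rightarrow> int) \<Rightarrow> ('i \<times> bool) list set monoid" where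
  "braid_group a = presented_group (braid_relations a)"

definition braid_gen :: "('i \<Rightarrow> 'i \<Rightarrow> int) \<Rightarrow> 'i \<Rightarrow> ('i \<times> bool) list set" where
  "braid_gen a i = word_class (braid_relations a) [(i, True)]"


section \<open>The two constructions yield a group and a unital associative algebra\<close>

lemma word_class_eq_iff: "word_class R u = word_class R v \<longleftrightarrow> word_equiv R u v"
proof
  assume "word_class R u = word_class R v"
  moreover have "v \<in> word_class R v" by (simp add: word_class_def word_equiv.refl)
  ultimately show "word_equiv R u v" by (simp add: word_class_def set_eq_iff)
next
  assume uv: "word_equiv R u v"
  have "word_equiv R u w \<longleftrightarrow> word_equiv R v w" for w
    using word_equiv.trans[OF uv] word_equiv.trans[OF word_equiv.sym[OF uv]] by blast
  then show "word_class R u = word_class R v" by (simp add: word_class_def)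
qed

lemma presented_group_mult:
  "word_class R u \<otimes>\<^bsub>presented_group R\<^esub> word_class R v = word_class R (u @ v)"
proof -
  have eq: "word_class R (u' @ v') = word_class R (u @ v)"
    if "u' \<in> word_class R u" "v' \<in> word_class R v" for u' v'
  proof -
    have "word_equiv R u u'" "word_equiv R v v'" using that by (simp_all add: word_class_def)
    then show ?thesis unfolding word_class_eq_iff
      by (rule word_equiv.sym[OF word_equiv.append])
  qed
  have "u \<in> word_class R u" "v \<in> word_class R v"
    by (simp_all add: word_class_def word_equiv.refl)
  then have "(\<Union>u'\<in>word_class R u. \<Union>v'\<in>word_class R v. word_class R (u' @ v')) = word_class R (u @ v)"
    using eq by blast
  then show ?thesis by (simp add: presented_group_def)
qed

lemma word_equiv_inverse: "word_equiv R (map (\<lambda>(x, b). (x, \<not> b)) (rev u) @ u) []"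
proof (induction u)
  case Nil
  show ?case by (simp add: word_equiv.refl)
next
  case (Cons l u)
  let ?w = "map (\<lambda>(x, b). (x, \<not> b)) (rev u)"
  obtain x b where l: "l = (x, b)" by (cases l)
  have "word_equiv R [(x, \<not> b), (x, b)] []"
    using word_equiv.cancel[of R x "\<not> b"] by simp
  then have "word_equiv R (?w @ ([(x, \<not> b), (x, b)] @ u)) (?w @ ([] @ u))"
    by (intro word_equiv.append word_equiv.refl)
  from word_equiv.trans[OF this] Cons.IH show ?case by (simp add: l)
qed

lemma group_presented_group: "group (presented_group R)"
proof (rule groupI)
  show "\<one>\<^bsub>presented_group R\<^esub> \<in> carrier (presented_group R)"
    by (simp add: presented_group_def)
next
  fix U Z assume "U \<in> carrier (presented_group R)" "Z \<in> carrier (presented_group R)"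
  then obtain u v where "U = word_class R u" "Z = word_class R v"
    by (auto simp: presented_group_def)
  then have "U \<otimes>\<^bsub>presented_group R\<^esub> Z = word_class R (u @ v)"
    by (simp add: presented_group_mult)
  then show "U \<otimes>\<^bsub>presented_group R\<^esub> Z \<in> carrier (presented_group R)"
    by (simp add: presented_group_def)
next
  fix U Z W assume "U \<in> carrier (presented_group R)" "Z \<in> carrier (presented_group R)"
    "W \<in> carrier (presented_group R)"
  then obtain u v w where "U = word_class R u" "Z = word_class R v" "W = word_class R w"
    by (auto simp: presented_group_def)
  then show "U \<otimes>\<^bsub>presented_group R\<^esub> Z \<otimes>\<^bsub>presented_group R\<^esub> W =
      U \<otimes>\<^bsub>presented_group R\<^esub> (Z \<otimes>\<^bsub>presented_group R\<^esub> W)"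
    by (simp add: presented_group_mult)
next
  fix U assume "U \<in> carrier (presented_group R)"
  then obtain u where U: "U = word_class R u" by (auto simp: presented_group_def)
  have one: "\<one>\<^bsub>presented_group R\<^esub> = word_class R []" by (simp add: presented_group_def)
  show "\<one>\<^bsub>presented_group R\<^esub> \<otimes>\<^bsub>presented_group R\<^esub> U = U"
    by (simp add: U one presented_group_mult)
  let ?Z = "word_class R (map (\<lambda>(x, b). (x, \<not> b)) (rev u))"
  have "?Z \<in> carrier (presented_group R)" by (simp add: presented_group_def)
  moreover have "?Z \<otimes>\<^bsub>presented_group R\<^esub> U = \<one>\<^bsub>presented_group R\<^esub>"
    by (simp add: U one presented_group_mult word_class_eq_iff word_equiv_inverse)
  ultimately show "\<exists>Z\<in>carrier (presented_group R).
      Z \<otimes>\<^bsub>presented_group R\<^esub> U = \<one>\<^bsub>presented_group R\<^esub>" by blast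
qed

lemma free_ring_sel:
  "carrier free_ring = UNIV" "monoid.mult free_ring = (*)" "one free_ring = 1"
  "ring.zero free_ring = 0" "ring.add free_ring = (+)"
  by (simp_all add: free_ring_def)

lemma ring_free_ring: "ring (free_ring :: ('x, 'k::field) free_algebra ring)"
proof (rule ringI)
  show "abelian_group (free_ring :: ('x, 'k) free_algebra ring)"
  proof (rule abelian_groupI, unfold free_ring_sel)
    fix p :: "('x, 'k) free_algebra"
    show "\<exists>q\<in>UNIV. q + p = 0"
      by (rule bexI[of _ "- p"]) (rule left_minus, rule UNIV_I)
  qed (rule UNIV_I add.assoc add.commute add_0_left)+
  show "Group.monoid (free_ring :: ('x, 'k) free_algebra ring)"
    by (rule monoidI, unfold free_ring_sel)
      (rule UNIV_I mult.assoc mult_1_left mult_1_right)+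
qed (unfold free_ring_sel, rule distrib_right, rule distrib_left)

lemma ideal_relators: "ideal (Idl\<^bsub>free_ring\<^esub> S) (free_ring :: ('x, 'k::field) free_algebra ring)"
  by (rule ring.genideal_ideal[OF ring_free_ring]) (simp add: free_ring_def)

lemma ring_presented_algebra: "ring (presented_algebra S)"
proof -
  define Q where "Q = free_ring Quot (Idl\<^bsub>free_ring\<^esub> S)"
  interpret Q: ring Q
    unfolding Q_def by (rule ideal.quotient_is_ring[OF ideal_relators])
  have sel: "carrier (presented_algebra S) = carrier Q"
    "monoid.mult (presented_algebra S) = monoid.mult Q" "one (presented_algebra S) = one Q"
    "ring.zero (presented_algebra S) = ring.zero Q" "ring.add (presented_algebra S) = ring.add Q"
    by (simp_all add: presented_algebra_def Let_def Q_def)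
  show ?thesis
  proof (rule ringI)
    show "abelian_group (presented_algebra S)"
    proof (rule abelian_groupI)
      fix x assume "x \<in> carrier (presented_algebra S)"
      then show "\<exists>z\<in>carrier (presented_algebra S).
          z \<oplus>\<^bsub>presented_algebra S\<^esub> x = \<zero>\<^bsub>presented_algebra S\<^esub>"
        unfolding sel using Q.l_neg Q.a_inv_closed by blast
    qed (simp_all add: sel Q.a_ac)
    show "Group.monoid (presented_algebra S)"
      by (rule monoidI) (simp_all add: sel Q.m_assoc)
  qed (simp_all add: sel Q.l_distr Q.r_distr)
qed

lemma free_const_central: "free_const c * p = p * free_const c"
proof (induction p rule: Poly_Mapping.update_induct)
  case const
  show ?case by simp
next
  case (update p k v)
  have "Poly_Mapping.update k v p = p + Poly_Mapping.single k v"
    using update(1) by (intro poly_mapping_eqI)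
      (auto simp: lookup_update lookup_add lookup_single when_def in_keys_iff)
  moreover have "free_const c * Poly_Mapping.single k v = Poly_Mapping.single k v * free_const c"
    by (simp add: free_const_def Poly_Mapping.mult_single mult.commute)
  ultimately show ?case using update(3) by (simp add: distrib_left distrib_right)
qed

lemma free_const_simps:
  "free_const (c + d) = free_const c + free_const d"
  "free_const (c * d) = free_const c * free_const d"
  "free_const 1 = 1"
  by (simp_all add: free_const_def single_add Poly_Mapping.mult_single)

lemma presented_algebra_smult:
  fixes S :: "('x, 'k::field) free_algebra set"
  defines "A \<equiv> presented_algebra S"
  assumes "x \<in> carrier A" "z \<in> carrier A"
  shows "c \<odot>\<^bsub>A\<^esub> x \<in> carrier A"
    and "1 \<odot>\<^bsub>A\<^esub> x = x"
    and "(c * d) \<odot>\<^bsub>A\<^esub> x = c \<odot>\<^bsub>A\<^esub> (d \<odot>\<^bsub>A\<^esub> x)"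
    and "(c + d) \<odot>\<^bsub>A\<^esub> x = c \<odot>\<^bsub>A\<^esub> x \<oplus>\<^bsub>A\<^esub> d \<odot>\<^bsub>A\<^esub> x"
    and "c \<odot>\<^bsub>A\<^esub> (x \<oplus>\<^bsub>A\<^esub> z) = c \<odot>\<^bsub>A\<^esub> x \<oplus>\<^bsub>A\<^esub> c \<odot>\<^bsub>A\<^esub> z"
    and "c \<odot>\<^bsub>A\<^esub> (x \<otimes>\<^bsub>A\<^esub> z) = (c \<odot>\<^bsub>A\<^esub> x) \<otimes>\<^bsub>A\<^esub> z"
    and "c \<odot>\<^bsub>A\<^esub> (x \<otimes>\<^bsub>A\<^esub> z) = x \<otimes>\<^bsub>A\<^esub> (c \<odot>\<^bsub>A\<^esub> z)"
proof -
  define I where "I = Idl\<^bsub>free_ring\<^esub> S"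
  define Q where "Q = free_ring Quot I"
  define q where "q = (\<lambda>p. I +>\<^bsub>free_ring\<^esub> p)"
  interpret Q: ring Q
    unfolding Q_def I_def by (rule ideal.quotient_is_ring[OF ideal_relators])
  have sel: "carrier A = carrier Q" "monoid.mult A = monoid.mult Q" "ring.add A = ring.add Q"
    "smult A = (\<lambda>c x. q (free_const c) \<otimes>\<^bsub>Q\<^esub> x)"
    by (simp_all add: A_def presented_algebra_def Let_def Q_def q_def I_def fun_eq_iff)
  have hom: "q \<in> ring_hom free_ring Q"
    unfolding q_def Q_def I_def by (rule ideal.rcos_ring_hom[OF ideal_relators])
  have q: "q p \<in> carrier Q" "q (p * r) = q p \<otimes>\<^bsub>Q\<^esub> q r" "q (p + r) = q p \<oplus>\<^bsub>Q\<^esub> q r"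
    "q 1 = \<one>\<^bsub>Q\<^esub>" for p r
    using ring_hom_closed[OF hom, of p] ring_hom_mult[OF hom, of p r] ring_hom_add[OF hom, of p r]
      ring_hom_one[OF hom] by (simp_all add: free_ring_def)
  have surj: "\<exists>p. u = q p" if "u \<in> carrier Q" for u
    using that by (auto simp: Q_def q_def FactRing_def A_RCOSETS_def' a_r_coset_def')
  have x: "x \<in> carrier Q" "z \<in> carrier Q" using assms(2,3) by (simp_all add: sel)
  have comm: "q (free_const c) \<otimes>\<^bsub>Q\<^esub> x = x \<otimes>\<^bsub>Q\<^esub> q (free_const c)"
  proof -
    obtain p where "x = q p" using surj[OF x(1)] by blast
    then show ?thesis by (simp add: q(2)[symmetric] free_const_central)
  qed
  show "c \<odot>\<^bsub>A\<^esub> x \<in> carrier A" "1 \<odot>\<^bsub>A\<^esub> x = x"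
    "(c * d) \<odot>\<^bsub>A\<^esub> x = c \<odot>\<^bsub>A\<^esub> (d \<odot>\<^bsub>A\<^esub> x)"
    "(c + d) \<odot>\<^bsub>A\<^esub> x = c \<odot>\<^bsub>A\<^esub> x \<oplus>\<^bsub>A\<^esub> d \<odot>\<^bsub>A\<^esub> x"
    "c \<odot>\<^bsub>A\<^esub> (x \<oplus>\<^bsub>A\<^esub> z) = c \<odot>\<^bsub>A\<^esub> x \<oplus>\<^bsub>A\<^esub> c \<odot>\<^bsub>A\<^esub> z"
    "c \<odot>\<^bsub>A\<^esub> (x \<otimes>\<^bsub>A\<^esub> z) = (c \<odot>\<^bsub>A\<^esub> x) \<otimes>\<^bsub>A\<^esub> z"
    using x by (simp_all add: sel q free_const_simps Q.m_assoc Q.l_distr Q.r_distr)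
  have "q (free_const c) \<otimes>\<^bsub>Q\<^esub> (x \<otimes>\<^bsub>Q\<^esub> z) = x \<otimes>\<^bsub>Q\<^esub> (q (free_const c) \<otimes>\<^bsub>Q\<^esub> z)"
    using Q.m_assoc[OF q(1) x] Q.m_assoc[OF x(1) q(1) x(2)] comm by metis
  then show "c \<odot>\<^bsub>A\<^esub> (x \<otimes>\<^bsub>A\<^esub> z) = x \<otimes>\<^bsub>A\<^esub> (c \<odot>\<^bsub>A\<^esub> z)"
    by (simp add: sel)
qed

end

theory Submission
  imports Defs
begin

text \<open>
  Write \<open>[x, y] = (t\<^sup>1\<^sup>/\<^sup>2 x y - t\<^sup>-\<^sup>1\<^sup>/\<^sup>2 y x) / (t - t\<^sup>-\<^sup>1)\<close>.  The formulas define an endomorphism \<open>\<sigma>\<^sub>i\<close> of the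
  free algebra on the \<open>y\<^sub>j\<^sub>,\<^sub>m\<close>, and every computation takes place there, as a congruence modulo the
  ideal \<open>I\<close> generated by the relators.  Three things have to be shown: \<open>\<sigma>\<^sub>i\<close> maps \<open>I\<close> into itself, it has
  an inverse modulo \<open>I\<close>, and the braid relations hold modulo \<open>I\<close>.

  Fix \<open>i\<close> and \<open>j\<close> with \<open>a\<^sub>i\<^sub>j = -1\<close>, and put \<open>P = [y\<^sub>j\<^sub>,\<^sub>m, y\<^sub>i\<^sub>,\<^sub>m]\<close>.  The heart of the matter is the identity
  \<open>[y\<^sub>i\<^sub>,\<^sub>m\<^sub>+\<^sub>1, P] = y\<^sub>j\<^sub>,\<^sub>m\<close> (\<open>bracket_shift_inverse\<close>): since \<open>y\<^sub>i\<^sub>,\<^sub>m\<^sub>+\<^sub>1\<close> and \<open>y\<^sub>i\<^sub>,\<^sub>m\<close> \<open>q\<close>-commute up to a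
  constant, bracketing with the first undoes bracketing with the second.  It says at once that
  \<open>\<sigma>\<^sub>i\<close> undoes the proposed \<open>\<sigma>\<^sub>i\<^sup>-\<^sup>1\<close>, that \<open>\<sigma>\<^sub>i \<sigma>\<^sub>j\<close> sends \<open>y\<^sub>i\<^sub>,\<^sub>m\<close> to \<open>y\<^sub>j\<^sub>,\<^sub>m\<close>, and, because
  \<open>y\<^sub>j\<^sub>,\<^sub>m\<close> \<open>q\<close>-commutes with \<open>y\<^sub>i\<^sub>,\<^sub>m\<^sub>+\<^sub>1\<close> and with \<open>P\<close>, that the images \<open>y\<^sub>i\<^sub>,\<^sub>m\<^sub>+\<^sub>1\<close> and \<open>P\<close> satisfy the Serre relations.

  That \<open>\<sigma>\<^sub>i\<close> preserves the other relators is mostly bookkeeping of exponents: if \<open>x\<close> \<open>q\<close>-commutes with \<open>y\<close>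
  and \<open>z\<close>, it \<open>q\<close>-commutes with \<open>[y, z]\<close>, and the exponents add up like the pairing of roots does under
  a simple reflection.  The exceptions are relations between adjacent levels
  (\<open>qcomm_bracket_shift\<close>, \<open>bracket_relation_shift\<close>) and the relations within one level that involve
  two brackets or one bracket twice (\<open>brackets_commute\<close>, \<open>serre_bracket_left\<close>), which are those that
  Lusztig's braid symmetries of the quantum group satisfy in rank three.  Positive definiteness
  of the Cartan matrix excludes triangles in the Dynkin diagram, so that two neighbours of \<open>i\<close> are
  never adjacent.

  The inverse needs no second round of computations: the anti-automorphism \<open>y\<^sub>j\<^sub>,\<^sub>m \<mapsto> y\<^sub>j\<^sub>,\<^sub>-\<^sub>m\<close> preserves \<open>I\<close>
  and conjugates \<open>\<sigma>\<^sub>i\<close> into \<open>\<sigma>\<^sub>i\<^sup>-\<^sup>1\<close>.  The braid relations, checked on generators, follow from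
  \<open>\<sigma>\<^sub>i \<sigma>\<^sub>j y\<^sub>i\<^sub>,\<^sub>m = y\<^sub>j\<^sub>,\<^sub>m\<close> and from \<open>[[x, y], z] = [x, [y, z]]\<close> for commuting \<open>x\<close> and \<open>z\<close>.
\<close>

section \<open>Congruences modulo a two-sided ideal\<close>

text \<open>
  The algebra is kept as a ring with a central ring homomorphism \<open>s\<close> from the scalars, and its quotient
  as a congruence on representatives, so that the ring operations stay those of the type class and
  an identity in the quotient is an explicit combination of elements of \<open>I\<close>.
\<close>
locale algebra_congruence =
  fixes s :: "'k::field \<Rightarrow> 'r::ring_1" and I :: "'r set"
  assumes s_add: "s (c + d) = s c + s d"
    and s_mult: "s (c * d) = s c * s d"
    and s_one: "s 1 = 1"
    and s_central: "s c * x = x * s c"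
    and I_zero: "0 \<in> I"
    and I_add: "x \<in> I \<Longrightarrow> y \<in> I \<Longrightarrow> x + y \<in> I"
    and I_left: "x \<in> I \<Longrightarrow> z * x \<in> I"
    and I_right: "x \<in> I \<Longrightarrow> x * z \<in> I"
begin

definition cong (infix "\<doteq>" 50) where
  "x \<doteq> y \<longleftrightarrow> x - y \<in> I"

lemma s_zero: "s 0 = 0"
  using s_add[of 0 0] by simp

lemma s_minus: "s (- c) = - s c"
  using s_add[of c "- c"] by (simp add: s_zero eq_neg_iff_add_eq_0 add.commute)

lemma s_diff: "s (c - d) = s c - s d"
  using s_add[of c "- d"] by (simp add: s_minus)

lemma s_right: "x * s c = s c * x"
  by (simp add: s_central)

lemma s_left_commute: "x * (s c * y) = s c * (x * y)"
  by (metis s_central mult.assoc)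

lemma s_assoc: "s c * (s d * x) = s (c * d) * x"
  by (simp add: s_mult mult.assoc)

lemma I_minus: "x \<in> I \<Longrightarrow> - x \<in> I"
  using I_left[of x "- 1"] by simp

lemma I_diff: "x \<in> I \<Longrightarrow> y \<in> I \<Longrightarrow> x - y \<in> I"
  using I_add[of x "- y"] by (simp add: I_minus)

lemma cong_refl [simp]: "x \<doteq> x"
  by (simp add: cong_def I_zero)

lemma cong_sym: "x \<doteq> y \<Longrightarrow> y \<doteq> x"
  using I_minus[of "x - y"] by (simp add: cong_def)

lemma cong_trans [trans]: "x \<doteq> y \<Longrightarrow> y \<doteq> z \<Longrightarrow> x \<doteq> z"
  using I_add[of "x - y" "y - z"] by (simp add: cong_def)

lemma cong_add: "x \<doteq> y \<Longrightarrow> x' \<doteq> y' \<Longrightarrow> x + x' \<doteq> y + y'"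
  using I_add[of "x - y" "x' - y'"] by (simp add: cong_def algebra_simps)

lemma cong_diff: "x \<doteq> y \<Longrightarrow> x' \<doteq> y' \<Longrightarrow> x - x' \<doteq> y - y'"
  using I_diff[of "x - y" "x' - y'"] by (simp add: cong_def algebra_simps)

lemma cong_left: "x \<doteq> y \<Longrightarrow> z * x \<doteq> z * y"
  using I_left[of "x - y" z] by (simp add: cong_def algebra_simps)

lemma cong_right: "x \<doteq> y \<Longrightarrow> x * z \<doteq> y * z"
  using I_right[of "x - y" z] by (simp add: cong_def algebra_simps)

lemma cong_mult: "x \<doteq> y \<Longrightarrow> x' \<doteq> y' \<Longrightarrow> x * x' \<doteq> y * y'"
  by (rule cong_trans[OF cong_right cong_left])

lemma I_scalar_iff: "c \<noteq> 0 \<Longrightarrow> s c * x \<in> I \<longleftrightarrow> x \<in> I"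
  using I_left[of x "s c"] I_left[of "s c * x" "s (inverse c)"]
  by (auto simp: s_assoc s_one)

lemma cong_scalar_cancel: "c \<noteq> 0 \<Longrightarrow> s c * x \<doteq> s c * y \<longleftrightarrow> x \<doteq> y"
  using I_scalar_iff[of c "x - y"] by (simp add: cong_def right_diff_distrib)

text \<open>
  Almost all relations of the algebra, and almost all that have to be transported along \<open>\<sigma>\<^sub>i\<close>, say that
  two elements commute up to a scalar; the factors multiply when products are formed.
\<close>
definition qcomm :: "'k \<Rightarrow> 'r \<Rightarrow> 'r \<Rightarrow> bool" where
  "qcomm \<alpha> x y \<longleftrightarrow> x * y \<doteq> s \<alpha> * (y * x)"

lemma qcomm_sym:
  assumes "qcomm \<alpha> x y" "\<alpha> \<noteq> 0" shows "qcomm (inverse \<alpha>) y x"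
proof -
  have "s (inverse \<alpha>) * (x * y) \<doteq> s (inverse \<alpha>) * (s \<alpha> * (y * x))"
    using assms(1) unfolding qcomm_def by (rule cong_left)
  then show ?thesis using assms(2) by (simp add: qcomm_def s_assoc s_one cong_sym)
qed

lemma qcomm_scalar_right:
  assumes "qcomm \<alpha> x y" shows "qcomm \<alpha> x (s c * y)"
proof -
  have "s c * (x * y) \<doteq> s c * (s \<alpha> * (y * x))"
    using assms unfolding qcomm_def by (rule cong_left)
  then show ?thesis by (simp add: qcomm_def s_left_commute[of x] mult.assoc s_assoc mult.commute[of c])
qed

lemma qcomm_scalar_left:
  assumes "qcomm \<alpha> x y" shows "qcomm \<alpha> (s c * x) y"
proof -
  have "s c * (x * y) \<doteq> s c * (s \<alpha> * (y * x))"
    using assms unfolding qcomm_def by (rule cong_left)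
  then show ?thesis by (simp add: qcomm_def s_left_commute[of y] mult.assoc s_assoc mult.commute[of c])
qed

lemma qcomm_diff_right:
  assumes "qcomm \<alpha> x y" "qcomm \<alpha> x z" shows "qcomm \<alpha> x (y - z)"
  using cong_diff[OF assms[unfolded qcomm_def]] by (simp add: qcomm_def algebra_simps)

lemma qcomm_diff_left:
  assumes "qcomm \<alpha> x z" "qcomm \<alpha> y z" shows "qcomm \<alpha> (x - y) z"
  using cong_diff[OF assms[unfolded qcomm_def]] by (simp add: qcomm_def algebra_simps)

lemma qcomm_mult_right:
  assumes "qcomm \<alpha> x y" "qcomm \<beta> x z" shows "qcomm (\<alpha> * \<beta>) x (y * z)"
proof -
  have "x * (y * z) \<doteq> s \<alpha> * (y * x) * z"
    using cong_right[OF assms(1)[unfolded qcomm_def], of z] by (simp add: mult.assoc)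
  also have "\<dots> = s \<alpha> * y * (x * z)" by (simp add: mult.assoc)
  also have "\<dots> \<doteq> s \<alpha> * y * (s \<beta> * (z * x))"
    using assms(2) by (intro cong_left) (simp add: qcomm_def)
  also have "\<dots> = s (\<alpha> * \<beta>) * (y * z * x)"
    by (simp add: s_mult mult.assoc s_left_commute[of y])
  finally show ?thesis by (simp add: qcomm_def)
qed

lemma qcomm_mult_left:
  assumes "qcomm \<alpha> x z" "qcomm \<beta> y z" shows "qcomm (\<alpha> * \<beta>) (x * y) z"
proof -
  have "x * y * z \<doteq> x * (s \<beta> * (z * y))"
    using cong_left[OF assms(2)[unfolded qcomm_def], of x] by (simp add: mult.assoc)
  also have "\<dots> = s \<beta> * (x * z) * y" by (simp add: mult.assoc s_left_commute[of x])
  also have "\<dots> \<doteq> s \<beta> * (s \<alpha> * (z * x)) * y"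
    using assms(1) by (intro cong_left cong_right) (simp add: qcomm_def)
  also have "\<dots> = s (\<alpha> * \<beta>) * (z * (x * y))"
    by (simp add: s_mult[symmetric] s_assoc mult.assoc mult.commute[of \<beta>])
  finally show ?thesis by (simp add: qcomm_def)
qed

end

section \<open>The bracket and the Serre relation\<close>

text \<open>
  The parameters \<open>h\<close> and \<open>t\<close> play \<open>t\<^sup>1\<^sup>/\<^sup>2\<close> and \<open>t\<close>.  The condition \<open>t\<^sup>2 \<noteq> 1\<close> is needed for the denominator of the
  bracket; \<open>t\<^sup>2 \<noteq> -1\<close> makes the quantum integer \<open>t + t\<^sup>-\<^sup>1\<close>, the middle coefficient of the Serre relation,
  invertible.
\<close>
locale quantum_congruence = algebra_congruence s I
  for s :: "'k::field \<Rightarrow> 'r::ring_1" and I +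
  fixes h t :: 'k
  assumes t_def: "t = h ^ 2" and t_nonzero: "t \<noteq> 0"
    and t_sq_ne_1: "t * t - 1 \<noteq> 0" and t_sq_ne_minus_1: "t * t + 1 \<noteq> 0"
begin

definition bracket :: "'r \<Rightarrow> 'r \<Rightarrow> 'r" where
  "bracket x y = s (inverse (t - inverse t)) * (s h * (x * y) - s (inverse h) * (y * x))"

definition serre :: "'r \<Rightarrow> 'r \<Rightarrow> bool" where
  "serre x y \<longleftrightarrow> x * x * y - s (t + inverse t) * (x * y * x) + y * x * x \<in> I"

text \<open>
  The bracket up to an invertible scalar, with polynomial coefficients in \<open>t\<close>: identities between
  brackets become identities of noncommutative polynomials in a central variable \<open>s t\<close>, which the
  simplifier can verify by expansion.
\<close>
definition qbracket :: "'r \<Rightarrow> 'r \<Rightarrow> 'r" where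
  "qbracket x y = s t * (x * y) - y * x"

definition bracket_scale :: 'k where
  "bracket_scale = inverse h * inverse (t - inverse t)"

lemma h_nonzero: "h \<noteq> 0" using t_nonzero t_def by auto

lemma t_minus_inverse_nonzero: "t - inverse t \<noteq> 0"
  using t_nonzero t_sq_ne_1 by (auto simp: field_simps)

lemma bracket_scale_nonzero: "bracket_scale \<noteq> 0"
  using h_nonzero t_minus_inverse_nonzero by (simp add: bracket_scale_def)

text \<open>
  The normalization of the bracket is chosen for this: \<open>(t\<^sup>2 - 1)\<^sup>2 / t\<close> is the constant that arises when two
  unscaled brackets meet across adjacent levels.
\<close>
lemma bracket_scale_sq: "bracket_scale * bracket_scale * ((t * t - 1) * (t * t - 1)) = t"
proof -
  define d where "d = t - inverse t"
  have d: "d \<noteq> 0" using t_minus_inverse_nonzero d_def by simp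
  have e: "t * t - 1 = t * d" using t_nonzero by (simp add: d_def field_simps)
  have "inverse h * inverse h = inverse t"
    by (simp add: t_def power2_eq_square)
  then have "bracket_scale * bracket_scale = inverse t * (inverse d * inverse d)"
    unfolding bracket_scale_def d_def[symmetric] by (metis mult.assoc mult.left_commute)
  then show ?thesis using d t_nonzero by (simp add: e field_simps)
qed

lemma bracket_eq: "bracket x y = s bracket_scale * qbracket x y"
proof -
  have "inverse h * t = h" using h_nonzero by (simp add: t_def power2_eq_square)
  then have "bracket_scale * t = inverse (t - inverse t) * h"
    unfolding bracket_scale_def by (metis mult.assoc mult.commute)
  then show ?thesis
    by (simp add: bracket_def qbracket_def s_assoc right_diff_distrib)
      (simp add: bracket_scale_def mult.commute)
qed

lemma cong_bracket: "x \<doteq> x' \<Longrightarrow> y \<doteq> y' \<Longrightarrow> bracket x y \<doteq> bracket x' y'"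
  unfolding bracket_def by (intro cong_left cong_diff cong_mult cong_refl)

lemma serre_iff:
  "serre x y \<longleftrightarrow> s t * (x * x * y) - (s t * s t + 1) * (x * y * x) + s t * (y * x * x) \<in> I"
proof -
  have "s t * s (t + inverse t) = s t * s t + 1"
    using t_nonzero s_mult[of t "inverse t"] by (simp add: s_add distrib_left s_one)
  then have "s t * (x * x * y - s (t + inverse t) * (x * y * x) + y * x * x) =
     s t * (x * x * y) - (s t * s t + 1) * (x * y * x) + s t * (y * x * x)"
    by (simp add: distrib_left right_diff_distrib mult.assoc[symmetric])
  then show ?thesis unfolding serre_def using I_scalar_iff[OF t_nonzero] by metis
qed

text \<open>
  The Serre relation is homogeneous, so it does not see the difference between \<open>bracket\<close> and \<open>qbracket\<close>.
\<close>
lemma serre_scale: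
  assumes "serre x y" shows "serre (s c * x) (s d * y)"
proof -
  have "s c * x * (s c * x) * (s d * y) - s (t + inverse t) * (s c * x * (s d * y) * (s c * x)) +
      s d * y * (s c * x) * (s c * x) =
    s (c * c * d) * (x * x * y - s (t + inverse t) * (x * y * x) + y * x * x)"
    by (simp add: mult.assoc s_left_commute[of x] s_left_commute[of y] s_assoc right_diff_distrib distrib_left
       mult.commute mult.left_commute)
  then show ?thesis using assms I_left unfolding serre_def by metis
qed

lemma qcomm_bracket_right:
  assumes "qcomm \<alpha> x y" "qcomm \<beta> x z" shows "qcomm (\<alpha> * \<beta>) x (bracket y z)"
  using qcomm_mult_right[OF assms] qcomm_mult_right[OF assms(2,1)]
  unfolding bracket_def mult.commute[of \<beta>] by (intro qcomm_scalar_right qcomm_diff_right)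

lemma qcomm_bracket_left:
  assumes "qcomm \<alpha> x z" "qcomm \<beta> y z" shows "qcomm (\<alpha> * \<beta>) (bracket x y) z"
  using qcomm_mult_left[OF assms] qcomm_mult_left[OF assms(2,1)]
  unfolding bracket_def mult.commute[of \<beta>] by (intro qcomm_scalar_left qcomm_diff_left)

section \<open>Relations satisfied by brackets\<close>

text \<open>
  In the following lemmas the claimed relation is written explicitly as a combination of the assumed
  ones, multiplied from both sides by ring elements; the equation of the two sides holds in the ring
  itself, and the combination lies in \<open>I\<close>.
\<close>

lemma qcomm_inverse_t_iff: "qcomm (inverse t) x y \<longleftrightarrow> s t * (x * y) \<doteq> y * x"
  unfolding qcomm_def using cong_scalar_cancel[OF t_nonzero, of "x * y" "s (inverse t) * (y * x)"] t_nonzero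
  by (simp add: s_assoc s_one)

text \<open>
  The Serre relation for \<open>y\<close> and \<open>x\<close> is a nested bracket: it says exactly that \<open>y\<close> \<open>q\<close>-commutes with
  \<open>[x, y]\<close>.  This and the next lemma are the two mirror images of that remark.
\<close>
lemma serre_qcomm_right:
  assumes "serre y x" shows "qcomm (inverse t) y (bracket x y)"
proof -
  have "s t * (y * qbracket x y) - qbracket x y * y =
      - (s t * (y * y * x) - (s t * s t + 1) * (y * x * y) + s t * (x * y * y))"
    by (simp add: qbracket_def algebra_simps s_left_commute[of y])
  then have "qcomm (inverse t) y (qbracket x y)"
    using assms I_minus unfolding qcomm_inverse_t_iff cong_def serre_iff by metis
  then show ?thesis by (simp add: bracket_eq qcomm_scalar_right)
qed

lemma serre_qcomm_left:
  assumes "serre x y" shows "qcomm t x (bracket x y)"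
proof -
  have "x * qbracket x y - s t * (qbracket x y * x) =
      s t * (x * x * y) - (s t * s t + 1) * (x * y * x) + s t * (y * x * x)"
    by (simp add: qbracket_def algebra_simps s_left_commute[of x])
  then have "qcomm t x (qbracket x y)"
    using assms unfolding qcomm_def cong_def serre_iff by metis
  then show ?thesis by (simp add: bracket_eq qcomm_scalar_right)
qed

text \<open>
  Moving \<open>u\<close> past \<open>y\<close> produces a constant, hence moving it past \<open>[x, y]\<close> produces a multiple of \<open>x\<close>; the
  two contributions, from \<open>x y\<close> and from \<open>y x\<close>, cancel.  In the application \<open>u\<close> lies one level below \<open>x\<close>
  and \<open>y\<close>, where the sum of the exponents is the one that \<open>\<sigma>\<^sub>i\<close> requires.
\<close>
lemma qcomm_bracket_shift:
  assumes ux: "qcomm (inverse t) u x"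
    and uy: "u * y \<doteq> s (t ^ 2) * (y * u) + s (1 - t ^ 2)"
  shows "qcomm t u (bracket x y)"
proof -
  let ?p = "s t * (u * x) - x * u" and ?r = "u * y - (s t * (s t * (y * u)) + (1 - s t * s t))"
  have "s t * (u * qbracket x y - s t * (qbracket x y * u)) =
     s t * (?p * y) + s t * (x * ?r) - s t * (?r * x) - s t * s t * (y * ?p)"
    by (simp add: qbracket_def algebra_simps s_left_commute[of x] s_left_commute[of y] s_left_commute[of u]
      s_right[of x] s_right[of y] s_right[of u])
  moreover have "?p \<in> I" using ux unfolding qcomm_inverse_t_iff cong_def .
  moreover have "?r \<in> I"
    using uy unfolding cong_def by (simp add: power2_eq_square s_mult s_diff s_one mult.assoc)
  ultimately have "u * qbracket x y - s t * (qbracket x y * u) \<in> I"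
    using I_scalar_iff[OF t_nonzero] I_add I_diff I_left I_right by metis
  then have "qcomm t u (qbracket x y)" by (simp add: qcomm_def cong_def)
  then show ?thesis by (simp add: bracket_eq qcomm_scalar_right)
qed

text \<open>
  The mirror image, with \<open>u\<close> one level above \<open>x\<close> and \<open>y\<close>: now the \<open>q\<close>-commuting parts cancel and the
  constants survive, leaving a multiple of \<open>x\<close>.
\<close>
lemma qbracket_shift_inverse:
  assumes xu: "qcomm (inverse t) x u"
    and yu: "y * u \<doteq> s (t ^ 2) * (u * y) + s (1 - t ^ 2)"
  shows "s t * qbracket u (qbracket x y) \<doteq> s ((t * t - 1) * (t * t - 1)) * x"
proof -
  define p where "p = s t * (x * u) - u * x"
  define r where "r = y * u - (s t * (s t * (u * y)) + (1 - s t * s t))"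
  have p: "p \<in> I" using xu unfolding qcomm_inverse_t_iff cong_def p_def .
  have r: "r \<in> I"
    using yu unfolding cong_def r_def by (simp add: power2_eq_square s_mult s_diff s_one mult.assoc)
  have "s t * qbracket u (qbracket x y) - (s t * s t - 1) * (s t * s t - 1) * x =
     - (s t * s t * (x * r)) - s t * s t * (s t * (p * y)) + y * p + r * x"
    unfolding p_def r_def
    by (simp add: qbracket_def algebra_simps s_left_commute[of x] s_left_commute[of y] s_left_commute[of u]
      s_right[of x] s_right[of y] s_right[of u])
  also have "\<dots> \<in> I" using p r by (blast intro: I_minus I_add I_diff I_left I_right)
  finally show ?thesis by (simp add: cong_def s_mult s_diff s_one)
qed

lemma qbracket_scalar:
  "qbracket (s c * x) y = s c * qbracket x y" "qbracket x (s c * y) = s c * qbracket x y"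
  by (simp_all add: qbracket_def right_diff_distrib mult.assoc s_left_commute[of x] s_left_commute[of y]
    s_left_commute[of "s t" c])

lemma bracket_bracket:
  "bracket u (bracket x y) = s (bracket_scale * bracket_scale) * qbracket u (qbracket x y)"
  "bracket (bracket x y) u = s (bracket_scale * bracket_scale) * qbracket (qbracket x y) u"
  by (simp_all add: bracket_eq qbracket_scalar s_assoc)

text \<open>
  For \<open>u = y\<^sub>i\<^sub>,\<^sub>m\<^sub>+\<^sub>1\<close>, \<open>x = y\<^sub>j\<^sub>,\<^sub>m\<close>, \<open>y = y\<^sub>i\<^sub>,\<^sub>m\<close> with \<open>i\<close> and \<open>j\<close> adjacent this is the identity on which everything
  rests: \<open>\<sigma>\<^sub>i \<sigma>\<^sub>i\<^sup>-\<^sup>1 y\<^sub>j\<^sub>,\<^sub>m = y\<^sub>j\<^sub>,\<^sub>m\<close> and \<open>\<sigma>\<^sub>i \<sigma>\<^sub>j y\<^sub>i\<^sub>,\<^sub>m = y\<^sub>j\<^sub>,\<^sub>m\<close>.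
\<close>
lemma bracket_shift_inverse:
  assumes xu: "qcomm (inverse t) x u"
    and yu: "y * u \<doteq> s (t ^ 2) * (u * y) + s (1 - t ^ 2)"
  shows "bracket u (bracket x y) \<doteq> x"
proof -
  have "s (bracket_scale * bracket_scale) * (s t * qbracket u (qbracket x y)) \<doteq>
      s (bracket_scale * bracket_scale) * (s ((t * t - 1) * (t * t - 1)) * x)"
    using qbracket_shift_inverse[OF assms] by (rule cong_left)
  also have "\<dots> = s t * x" unfolding s_assoc bracket_scale_sq ..
  finally have "s t * bracket u (bracket x y) \<doteq> s t * x"
    unfolding bracket_bracket s_left_commute[of "s t" "bracket_scale * bracket_scale"] .
  then show ?thesis by (simp only: cong_scalar_cancel[OF t_nonzero])
qed

text \<open>
  Converse of \<open>serre_qcomm_right\<close> and \<open>serre_qcomm_left\<close>: a \<open>q\<close>-commutation with \<open>[u, x]\<close> is a Serre relation.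
  When \<open>[u, x]\<close> is congruent to a generator \<open>z\<close>, as in \<open>bracket_shift_inverse\<close>, that \<open>q\<close>-commutation is a
  defining relation or follows from one.
\<close>
lemma serre_of_bracket_left:
  assumes D: "bracket u x \<doteq> z" and zu: "qcomm (inverse t) z u"
  shows "serre u x"
proof -
  let ?D = "qbracket u x"
  have "qcomm (inverse t) (bracket u x) u"
    using zu D cong_left cong_right cong_sym cong_trans unfolding qcomm_def by meson
  then have "s t * (bracket u x * u) \<doteq> u * bracket u x" by (simp add: qcomm_inverse_t_iff)
  then have "s bracket_scale * (s t * (?D * u)) \<doteq> s bracket_scale * (u * ?D)"
    by (simp add: bracket_eq mult.assoc s_left_commute[of u] s_assoc mult.commute mult.left_commute)
  then have "u * ?D - s t * (?D * u) \<in> I"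
    using cong_scalar_cancel[OF bracket_scale_nonzero] cong_sym by (simp add: cong_def)
  moreover have "u * ?D - s t * (?D * u) =
      s t * (u * u * x) - (s t * s t + 1) * (u * x * u) + s t * (x * u * u)"
    by (simp add: qbracket_def algebra_simps s_left_commute[of u] s_left_commute[of x])
  ultimately show ?thesis unfolding serre_iff by metis
qed

lemma serre_of_bracket_right:
  assumes D: "bracket u x \<doteq> z" and xz: "qcomm (inverse t) x z"
  shows "serre x u"
proof -
  let ?D = "qbracket u x"
  have "qcomm (inverse t) x (bracket u x)"
    using xz D cong_left cong_right cong_sym cong_trans unfolding qcomm_def by meson
  then have "s t * (x * bracket u x) \<doteq> bracket u x * x" by (simp add: qcomm_inverse_t_iff)
  then have "s bracket_scale * (s t * (x * ?D)) \<doteq> s bracket_scale * (?D * x)"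
    by (simp add: bracket_eq mult.assoc s_left_commute[of x] s_assoc mult.commute mult.left_commute)
  then have "?D * x - s t * (x * ?D) \<in> I"
    using cong_scalar_cancel[OF bracket_scale_nonzero] cong_sym by (simp add: cong_def)
  moreover have "?D * x - s t * (x * ?D) =
      s t * (x * x * u) - (s t * s t + 1) * (x * u * x) + s t * (u * x * x)"
    by (simp add: qbracket_def algebra_simps s_left_commute[of u] s_left_commute[of x])
  ultimately show ?thesis unfolding serre_iff by metis
qed

text \<open>
  The two sides differ by a scalar multiple of the commutator of \<open>x z - z x\<close> with \<open>y\<close>.  This is
  the braid relation on a generator adjacent to exactly one of the two nodes.
\<close>
lemma bracket_assoc:
  assumes "x * z \<doteq> z * x"
  shows "bracket (bracket x y) z \<doteq> bracket x (bracket y z)"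
proof -
  have "qbracket (qbracket x y) z - qbracket x (qbracket y z) =
    s t * ((x * z - z * x) * y) - s t * (y * (x * z - z * x))"
    by (simp add: qbracket_def algebra_simps s_left_commute[of x] s_left_commute[of y] s_left_commute[of z])
  then have "qbracket (qbracket x y) z \<doteq> qbracket x (qbracket y z)"
    using assms I_diff I_left I_right unfolding cong_def by metis
  then show ?thesis unfolding bracket_bracket by (rule cong_left)
qed

text \<open>
  This is \<open>\<sigma>\<^sub>i \<sigma>\<^sub>j = \<sigma>\<^sub>j \<sigma>\<^sub>i\<close> on a generator adjacent to the two nodes \<open>i\<close> and \<open>j\<close>.
\<close>
lemma bracket_swap_right:
  assumes "y * z \<doteq> z * y"
  shows "bracket (bracket x y) z \<doteq> bracket (bracket x z) y"
proof -
  have "qbracket (qbracket x y) z - qbracket (qbracket x z) y =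
    s t * (s t * (x * (y * z - z * y))) - (y * z - z * y) * x"
    by (simp add: qbracket_def algebra_simps s_left_commute[of x] s_left_commute[of y] s_left_commute[of z])
  then have "qbracket (qbracket x y) z \<doteq> qbracket (qbracket x z) y"
    using assms I_diff I_left I_right unfolding cong_def by metis
  then show ?thesis unfolding bracket_bracket by (rule cong_left)
qed

lemma bracket_mult_bracket:
  "bracket x y * bracket z w = s (bracket_scale * bracket_scale) * (qbracket x y * qbracket z w)"
  by (simp add: bracket_eq mult.assoc s_left_commute[of "qbracket x y"] s_assoc)

text \<open>
  Here \<open>x\<close> and \<open>z\<close> are the two outer nodes of a diagram of type \<open>A\<^sub>3\<close> and \<open>y\<close> is the middle one.  In the
  difference of the two products, \<open>y x y\<close> and \<open>y z y\<close> occur only through \<open>x y z y\<close>, \<open>y x y z\<close> and their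
  reversals; the Serre relations replace \<open>(t + t\<^sup>-\<^sup>1) y x y\<close> by \<open>y\<^sup>2 x + x y\<^sup>2\<close>, and what remains cancels as
  \<open>x\<close> and \<open>z\<close> commute.  So the claim is obtained multiplied by \<open>t\<^sup>2 + 1\<close>.
\<close>
lemma brackets_commute:
  assumes xz: "x * z \<doteq> z * x" and sx: "serre y x" and sz: "serre y z"
  shows "bracket x y * bracket z y \<doteq> bracket z y * bracket x y"
proof -
  define q where "q = x * z - z * x"
  define S where "S = (\<lambda>x. s t * (y * y * x) - (s t * s t + 1) * (y * x * y) + s t * (x * y * y))"
  have q: "q \<in> I" using xz by (simp add: q_def cong_def)
  have Sx: "S x \<in> I" and Sz: "S z \<in> I" using sx sz by (simp_all add: S_def serre_iff)
  have "(s t * s t + 1) * (qbracket x y * qbracket z y - qbracket z y * qbracket x y) =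
      - (s t * s t * (x * S z)) - S x * z + s t * s t * (z * S x) + S z * x
      + s t * s t * s t * (q * y * y) + s t * (y * y * q) - s t * ((s t * s t + 1) * (y * q * y))"
    unfolding q_def S_def
    by (simp add: qbracket_def algebra_simps s_left_commute[of x] s_left_commute[of y] s_left_commute[of z])
  also have "\<dots> \<in> I" using q Sx Sz by (blast intro: I_minus I_add I_diff I_left I_right)
  also have "s t * s t + 1 = s (t * t + 1)" by (simp add: s_add s_mult s_one)
  finally have "qbracket x y * qbracket z y \<doteq> qbracket z y * qbracket x y"
    unfolding I_scalar_iff[OF t_sq_ne_minus_1] cong_def .
  then show ?thesis unfolding bracket_mult_bracket by (rule cong_left)
qed

text \<open>
  The relation between \<open>x\<close> (level \<open>m\<close>) and \<open>z\<close> (level \<open>m + 1\<close>) is carried over verbatim, constant term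
  included, to \<open>[x, y]\<close> and \<open>[z, w]\<close>, where \<open>y\<close> and \<open>w\<close> are the generators at node \<open>i\<close>.  With \<open>\<alpha> = t\<^sup>2\<close> and
  \<open>r = 1 - t\<^sup>2\<close> this gives the relation at one node, with \<open>\<alpha> = 1\<close> and \<open>r = 0\<close> the one between two
  neighbours of \<open>i\<close>.  Passing \<open>[x, y]\<close> over \<open>z\<close> costs a scalar (\<open>k\<close> below), and passing it over \<open>w\<close> costs a
  multiple of \<open>x\<close> (\<open>f\<close> below), which then meets \<open>z\<close> and returns the constant \<open>r\<close>.
\<close>
lemma bracket_relation_shift:
  assumes xz: "x * z \<doteq> s \<alpha> * (z * x) + s r"
    and xw: "qcomm (inverse t) x w" and yz: "qcomm (inverse t) y z"
    and yw: "y * w \<doteq> s (t ^ 2) * (w * y) + s (1 - t ^ 2)"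
  shows "bracket x y * bracket z w \<doteq> s \<alpha> * (bracket z w * bracket x y) + s r"
proof -
  define c where "c = (t * t - 1) * (t * t - 1)"
  define P where "P = qbracket x y"
  define W where "W = qbracket z w"
  define g where "g = x * z - (s \<alpha> * (z * x) + s r)"
  define p where "p = s t * (y * z) - z * y"
  define k where "k = s t * (P * z) - s \<alpha> * (z * P)"
  define f where "f = s t * (s t * (w * P) - P * w) - s c * x"
  have g: "g \<in> I" using xz by (simp add: g_def cong_def)
  have p: "p \<in> I" using yz unfolding qcomm_inverse_t_iff cong_def p_def .
  have f: "f \<in> I" using qbracket_shift_inverse[OF xw yw]
    unfolding f_def c_def cong_def P_def qbracket_def[of w] .
  have "k = s t * (x * p) + s t * (g * y) - s t * (y * g) - s \<alpha> * (p * x)"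
    unfolding k_def P_def g_def p_def qbracket_def
    by (simp add: algebra_simps s_left_commute[of x] s_left_commute[of y] s_left_commute[of z]
      s_left_commute[of "s \<alpha>" t] s_right[of x] s_right[of y])
  also have "\<dots> \<in> I" using p g by (blast intro: I_minus I_add I_diff I_left I_right)
  finally have k: "k \<in> I" .
  have "s t * (P * W) - s t * (s \<alpha> * (W * P)) - s c * s r =
      s t * (k * w) - s \<alpha> * (z * f) + f * z - s t * (w * k) + s c * g"
    unfolding k_def f_def g_def W_def qbracket_def
    by (simp add: algebra_simps s_left_commute[of x] s_left_commute[of z] s_left_commute[of w] s_left_commute[of P]

      s_left_commute[of "s c" \<alpha>] s_left_commute[of "s \<alpha>" t] s_left_commute[of "s c" t])
  also have "\<dots> \<in> I" using k f g by (blast intro: I_minus I_add I_diff I_left I_right)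
  finally have "s (bracket_scale * bracket_scale) * (s t * (P * W) - s t * (s \<alpha> * (W * P)) - s c * s r) \<in> I"
    by (rule I_left)
  also have "s (bracket_scale * bracket_scale) * (s t * (P * W) - s t * (s \<alpha> * (W * P)) - s c * s r) =
    s t * (bracket x y * bracket z w - (s \<alpha> * (bracket z w * bracket x y) + s r))"
  proof -
    have "s (bracket_scale * bracket_scale) * s c = s t"
      using bracket_scale_sq by (simp add: c_def s_mult[symmetric])
    then have "s (bracket_scale * bracket_scale) * (s c * s r) = s t * s r"
      by (simp add: mult.assoc[symmetric])
    then show ?thesis
      unfolding bracket_mult_bracket P_def[symmetric] W_def[symmetric] right_diff_distrib distrib_left
      by (simp add: s_left_commute[of "s t" "bracket_scale * bracket_scale"]
        s_left_commute[of "s \<alpha>" "bracket_scale * bracket_scale"])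
  qed
  finally show ?thesis unfolding I_scalar_iff[OF t_nonzero] cong_def .
qed

text \<open>
  As \<open>z\<close> commutes with \<open>y\<close>, the Serre expression of \<open>z\<close> and \<open>[x, y]\<close> is the bracket of that of \<open>z\<close> and \<open>x\<close>
  with \<open>y\<close>.
\<close>
lemma serre_bracket_right:
  assumes yz: "y * z \<doteq> z * y" and "serre z x"
  shows "serre z (bracket x y)"
proof -
  define q where "q = y * z - z * y"
  define S where "S = (\<lambda>x. s t * (z * z * x) - (s t * s t + 1) * (z * x * z) + s t * (x * z * z))"
  have q: "q \<in> I" using yz by (simp add: q_def cong_def)
  have Sx: "S x \<in> I" using assms by (simp add: S_def serre_iff)
  have "S (qbracket x y) =
     s t * (S x * y - (s t * s t + 1) * (z * x * q) + s t * (x * (q * z + z * q)))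
     - (y * S x - s t * ((z * q + q * z) * x) + (s t * s t + 1) * (q * x * z))"
    unfolding S_def q_def qbracket_def
    by (simp add: algebra_simps s_left_commute[of x] s_left_commute[of y] s_left_commute[of z])
  also have "\<dots> \<in> I" using q Sx by (blast intro: I_minus I_add I_diff I_left I_right)
  finally have "serre z (qbracket x y)" by (simp add: S_def serre_iff)
  then show ?thesis using serre_scale[of z "qbracket x y" 1] by (simp add: bracket_eq s_one)
qed

text \<open>
  The nodes \<open>y\<close>, \<open>x\<close>, \<open>z\<close> form a diagram of type \<open>A\<^sub>3\<close> with \<open>x\<close> in the middle.  Up to scalars, \<open>P\<close>, \<open>A\<close> and
  \<open>V\<close> are the root vectors of the roots \<open>x + y\<close>, \<open>x + z\<close> and \<open>x + y + z\<close>, and the Serre relation for \<open>P\<close> and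
  \<open>z\<close> is the \<open>q\<close>-commutation of \<open>P\<close> with \<open>V = P z - t z P\<close>.  The proof derives the straightening
  relations between root vectors: \<open>V\<close> is also a bracket of \<open>A\<close> with \<open>y\<close> (\<open>v\<close>), \<open>x\<close> commutes with \<open>V\<close> (\<open>e3\<close>), and
  \<open>P A - A P\<close> is a multiple of \<open>x V\<close> (\<open>k\<close>).  Expanding \<open>V\<close> in the product \<open>P V\<close> as a bracket of \<open>A\<close> and \<open>y\<close>
  then reduces the claim to these.
\<close>
lemma serre_bracket_left:
  assumes yz: "y * z \<doteq> z * y" and sxy: "serre x y" and syx: "serre y x" and sxz: "serre x z"
  shows "serre (bracket x y) z"
proof -
  define P where "P = s t * (x * y) - y * x"
  define A where "A = x * z - s t * (z * x)"
  define V where "V = P * z - s t * (z * P)"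
  define q where "q = y * z - z * y"
  define v where "v = V - s t * (A * y) + y * A"
  define f1 where "f1 = s t * (x * A) - A * x"
  define f2 where "f2 = x * P - s t * (P * x)"
  define f3 where "f3 = s t * (y * P) - P * y"
  define f4 where "f4 = s t * (y * V) - V * y"
  define e1 where "e1 = x * V - s t * (P * A - A * P) - s t * s t * (V * x)"
  define e2 where "e2 = s t * (P * A - A * P) + s t * s t * (x * V) - V * x"
  define k where "k = s t * (P * A - A * P) - (1 - s t * s t) * (x * V)"
  note alg = algebra_simps s_left_commute[of x] s_left_commute[of y] s_left_commute[of z]
    s_left_commute[of P] s_left_commute[of A] s_left_commute[of V]
  note ideal = I_minus I_add I_diff I_left I_right
  have q: "q \<in> I" using yz by (simp add: q_def cong_def)
  have "v = s t * (x * q) - s t * (q * x)" unfolding v_def V_def A_def P_def q_def by (simp add: alg)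
  then have v: "v \<in> I" using q by (auto intro!: I_diff intro: I_left I_right)
  have "f1 = s t * (x * x * z) - (s t * s t + 1) * (x * z * x) + s t * (z * x * x)"
    unfolding f1_def A_def by (simp add: alg)
  then have f1: "f1 \<in> I" using sxz by (simp add: serre_iff)
  have "f2 = s t * (x * x * y) - (s t * s t + 1) * (x * y * x) + s t * (y * x * x)"
    unfolding f2_def P_def by (simp add: alg)
  then have f2: "f2 \<in> I" using sxy by (simp add: serre_iff)
  have "f3 = - (s t * (y * y * x) - (s t * s t + 1) * (y * x * y) + s t * (x * y * y))"
    unfolding f3_def P_def by (simp add: alg)
  then have f3: "f3 \<in> I" using syx I_minus unfolding serre_iff by metis
  have "f4 = f3 * z + P * q - s t * (z * f3) - s t * (s t * (q * P))"
    unfolding f4_def f3_def V_def q_def by (simp add: alg)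
  then have f4: "f4 \<in> I" using f3 q by (blast intro: ideal)
  \<comment> \<open>Two ways of moving \<open>x\<close> past \<open>V\<close>: \<open>e1\<close> reads \<open>V\<close> as a bracket of \<open>P\<close> with \<open>z\<close>, \<open>e2\<close> as one of \<open>A\<close> with \<open>y\<close>.
    In their sum \<open>P A - A P\<close> drops out, leaving \<open>(t\<^sup>2 + 1) (x V - V x)\<close>.\<close>
  have "e1 = f2 * z - s t * s t * (z * f2)"
    unfolding e1_def f2_def V_def A_def by (simp add: alg)
  then have e1: "e1 \<in> I" using f2 by (blast intro: ideal)
  have "e2 = s t * s t * (f1 * y) - y * f1 + s t * s t * (x * v) - v * x"
    unfolding e2_def f1_def v_def P_def by (simp add: alg)
  then have e2: "e2 \<in> I" using f1 v by (blast intro: ideal)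
  have "e1 + e2 = s (t * t + 1) * (x * V - V * x)"
    unfolding e1_def e2_def by (simp add: alg s_add s_mult s_one)
  then have e3: "x * V - V * x \<in> I" using I_scalar_iff[OF t_sq_ne_minus_1] I_add[OF e1 e2] by metis
  have "k = - e1 + s t * s t * (x * V - V * x)"
    unfolding k_def e1_def by (simp add: alg)
  then have k: "k \<in> I" using e1 e3 by (blast intro: ideal)
  \<comment> \<open>\<open>P\<close> and \<open>V\<close> are moved past \<open>y\<close> by \<open>f3\<close> and \<open>f4\<close>.  The two multiples of \<open>P V\<close> that arise, one from
    straightening \<open>P A\<close> and one from \<open>x V y\<close>, cancel.\<close>
  have "s t * (s t * (P * V) - V * P) =
     s t * s t * (P * v) - s t * (v * P) + s t * s t * (f3 * A) - s t * (A * f3)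
     - (s t * s t - 1) * (P * v + f3 * A) + (s t * s t - 1) * (x * f4) + k * y - y * k"
    unfolding v_def f3_def f4_def k_def P_def by (simp add: alg)
  also have "\<dots> \<in> I" using v f3 f4 k by (blast intro: ideal)
  finally have "s t * (P * V) - V * P \<in> I" unfolding I_scalar_iff[OF t_nonzero] .
  also have "s t * (P * V) - V * P =
     s t * (P * P * z) - (s t * s t + 1) * (P * z * P) + s t * (z * P * P)"
    unfolding V_def by (simp add: alg)
  finally have "serre P z" by (simp add: serre_iff)
  then show ?thesis using serre_scale[of P z bracket_scale 1] by (simp add: bracket_eq qbracket_def P_def s_one)
qed

end

section \<open>Endomorphisms of free algebras\<close>

lemma free_algebra_single_induct [case_names single add]:
  fixes P :: "('x, 'k::field) free_algebra \<Rightarrow> bool"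
  assumes "\<And>w c. P (Poly_Mapping.single w c)" "\<And>p q. P p \<Longrightarrow> P q \<Longrightarrow> P (p + q)"
  shows "P p"
proof (induction p rule: Poly_Mapping.update_induct)
  case const
  show ?case using assms(1)[of 0 0] by simp
next
  case (update p k v)
  have "Poly_Mapping.update k v p = p + Poly_Mapping.single k v"
    using update(1) by (intro poly_mapping_eqI)
      (auto simp: lookup_update lookup_add lookup_single when_def in_keys_iff)
  then show ?case using assms update(3) by simp
qed

lemma free_const_left_commute: "p * (free_const c * q) = free_const c * (p * q)"
  by (metis free_const_central mult.assoc)

lemma single_word: "Poly_Mapping.single (FWord l) c = free_const c * prod_list (map free_gen l)"
proof (induction l arbitrary: c)
  case Nil
  show ?case by (simp add: free_const_def zero_fword_def)
next
  case (Cons x l)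
  have "Poly_Mapping.single (FWord (x # l)) c = free_gen x * Poly_Mapping.single (FWord l) c"
    by (simp add: free_gen_def Poly_Mapping.mult_single)
  also have "\<dots> = free_const c * (free_gen x * prod_list (map free_gen l))"
    unfolding Cons.IH by (rule free_const_left_commute)
  finally show ?case by simp
qed

lemma free_algebra_induct [case_names const gen add mult]:
  fixes P :: "('x, 'k::field) free_algebra \<Rightarrow> bool"
  assumes "\<And>c. P (free_const c)" "\<And>x. P (free_gen x)"
    "\<And>p q. P p \<Longrightarrow> P q \<Longrightarrow> P (p + q)" "\<And>p q. P p \<Longrightarrow> P q \<Longrightarrow> P (p * q)"
  shows "P p"
proof (induction p rule: free_algebra_single_induct)
  case (single w c)
  obtain l where w: "w = FWord l" by (cases w)
  have "P (prod_list (map free_gen l))"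
    using assms(1)[of 1] by (induction l) (simp_all add: assms free_const_simps)
  then show ?case by (simp add: w single_word assms)
qed (rule assms)

text \<open>
  Extending a map on words linearly covers both homomorphisms and anti-homomorphisms, according to
  whether the map on words preserves or reverses products.
\<close>
definition linear_ext :: "('x fword \<Rightarrow> ('x, 'k::field) free_algebra) \<Rightarrow>
    ('x, 'k) free_algebra \<Rightarrow> ('x, 'k) free_algebra" where
  "linear_ext E p = (\<Sum>w\<in>Poly_Mapping.keys p. free_const (Poly_Mapping.lookup p w) * E w)"

lemma free_const_zero: "free_const 0 = 0"
  by (simp add: free_const_def)

lemma linear_ext_superset:
  assumes "finite S" "Poly_Mapping.keys p \<subseteq> S"
  shows "linear_ext E p = (\<Sum>w\<in>S. free_const (Poly_Mapping.lookup p w) * E w)"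
  unfolding linear_ext_def using assms
  by (intro sum.mono_neutral_left) (auto simp: in_keys_iff free_const_zero)

lemma linear_ext_add: "linear_ext E (p + q) = linear_ext E p + linear_ext E q"
proof -
  let ?S = "Poly_Mapping.keys p \<union> Poly_Mapping.keys q"
  have "Poly_Mapping.keys (p + q) \<subseteq> ?S" by (rule Poly_Mapping.keys_add)
  then show ?thesis
    by (simp add: linear_ext_superset[of ?S] lookup_add free_const_simps distrib_right sum.distrib)
qed

lemma linear_ext_single: "linear_ext E (Poly_Mapping.single w c) = free_const c * E w"
  by (simp add: linear_ext_superset[of "{w}"])

lemma linear_ext_mult:
  assumes "\<And>u v. E (u + v) = E u * E v"
  shows "linear_ext E (p * q) = linear_ext E p * linear_ext E q"
proof (induction p rule: free_algebra_single_induct)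
  case (single w c)
  show ?case
  proof (induction q rule: free_algebra_single_induct)
    case (single v d)
    have "E w * (free_const d * E v) = free_const d * (E w * E v)"
      by (rule free_const_left_commute)
    then show ?case by (simp add: Poly_Mapping.mult_single linear_ext_single assms free_const_simps mult.assoc)
  qed (simp add: distrib_left linear_ext_add)
qed (simp add: distrib_right linear_ext_add)

lemma linear_ext_mult_reversed:
  assumes "\<And>u v. E (u + v) = E v * E u"
  shows "linear_ext E (p * q) = linear_ext E q * linear_ext E p"
proof (induction p rule: free_algebra_single_induct)
  case (single w c)
  show ?case
  proof (induction q rule: free_algebra_single_induct)
    case (single v d)
    have "E v * (free_const c * E w) = free_const c * (E v * E w)"
      by (rule free_const_left_commute)
    then show ?case
      by (simp add: Poly_Mapping.mult_single linear_ext_single assms free_const_simps mult.assoc mult.commute[of c])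
  qed (simp add: distrib_left distrib_right linear_ext_add)
qed (simp add: distrib_left distrib_right linear_ext_add)

fun word_eval :: "('x \<Rightarrow> 'r::monoid_mult) \<Rightarrow> 'x fword \<Rightarrow> 'r" where
  "word_eval g (FWord l) = prod_list (map g l)"

fun word_eval_rev :: "('x \<Rightarrow> 'r::monoid_mult) \<Rightarrow> 'x fword \<Rightarrow> 'r" where
  "word_eval_rev g (FWord l) = prod_list (map g (rev l))"

lemma word_eval_plus: "word_eval g (u + v) = word_eval g u * word_eval g v"
  by (cases u; cases v) simp

lemma word_eval_rev_plus: "word_eval_rev g (u + v) = word_eval_rev g v * word_eval_rev g u"
  by (cases u; cases v) simp

definition alg_endo :: "(('x, 'k::field) free_algebra \<Rightarrow> ('x, 'k) free_algebra) \<Rightarrow> bool" where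
  "alg_endo f \<longleftrightarrow> (\<forall>p q. f (p + q) = f p + f q) \<and> (\<forall>p q. f (p * q) = f p * f q) \<and>
     (\<forall>c. f (free_const c) = free_const c)"

definition alg_anti_endo :: "(('x, 'k::field) free_algebra \<Rightarrow> ('x, 'k) free_algebra) \<Rightarrow> bool" where
  "alg_anti_endo f \<longleftrightarrow> (\<forall>p q. f (p + q) = f p + f q) \<and> (\<forall>p q. f (p * q) = f q * f p) \<and>
     (\<forall>c. f (free_const c) = free_const c)"

lemma additive_diff:
  fixes f :: "'r::ab_group_add \<Rightarrow> 'r"
  assumes "\<And>p q. f (p + q) = f p + f q"
  shows "f (p - q) = f p - f q"
  using assms[of "p - q" q] by (simp add: algebra_simps)

lemma alg_endo_simps:
  assumes "alg_endo f"
  shows "f (p + q) = f p + f q" "f (p * q) = f p * f q" "f (free_const c) = free_const c"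
    "f (p - q) = f p - f q"
  using assms additive_diff[of f p q] by (simp_all add: alg_endo_def)

lemma alg_anti_endo_simps:
  assumes "alg_anti_endo f"
  shows "f (p + q) = f p + f q" "f (p * q) = f q * f p" "f (free_const c) = free_const c"
    "f (p - q) = f p - f q"
  using assms additive_diff[of f p q] by (simp_all add: alg_anti_endo_def)

definition subst_gens :: "('x \<Rightarrow> ('x, 'k::field) free_algebra) \<Rightarrow> ('x, 'k) free_algebra \<Rightarrow> ('x, 'k) free_algebra" where
  "subst_gens g = linear_ext (word_eval g)"

definition subst_gens_rev :: "('x \<Rightarrow> ('x, 'k::field) free_algebra) \<Rightarrow> ('x, 'k) free_algebra \<Rightarrow> ('x, 'k) free_algebra" where
  "subst_gens_rev g = linear_ext (word_eval_rev g)"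

lemma linear_ext_free_const: "E 0 = 1 \<Longrightarrow> linear_ext E (free_const c) = free_const c"
  unfolding free_const_def[of c] linear_ext_single by simp

lemma alg_endo_subst_gens: "alg_endo (subst_gens g)"
  unfolding alg_endo_def subst_gens_def
  by (simp add: linear_ext_add linear_ext_mult word_eval_plus linear_ext_free_const zero_fword_def)

lemma alg_anti_endo_subst_gens_rev: "alg_anti_endo (subst_gens_rev g)"
  unfolding alg_anti_endo_def subst_gens_rev_def
  by (simp add: linear_ext_add linear_ext_mult_reversed word_eval_rev_plus linear_ext_free_const zero_fword_def)

lemma subst_gens_gen: "subst_gens g (free_gen x) = g x" "subst_gens_rev g (free_gen x) = g x"
  by (simp_all add: subst_gens_def subst_gens_rev_def free_gen_def linear_ext_single free_const_simps)

lemma alg_endo_comp: "alg_endo f \<Longrightarrow> alg_endo g \<Longrightarrow> alg_endo (f \<circ> g)"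
  by (simp add: alg_endo_def)

lemma alg_endo_id: "alg_endo id"
  by (simp add: alg_endo_def)

lemma alg_endo_conjugate: "alg_endo f \<Longrightarrow> alg_anti_endo r \<Longrightarrow> alg_endo (r \<circ> f \<circ> r)"
  by (simp add: alg_endo_def alg_anti_endo_def)

lemma alg_endo_eqI:
  assumes "alg_endo f" "alg_endo g" "\<And>x. f (free_gen x) = g (free_gen x)"
  shows "f p = g p"
  by (induction p rule: free_algebra_induct) (use assms in \<open>simp_all add: alg_endo_def\<close>)

section \<open>The ideal generated by the relators\<close>

lemma free_ring_a_inv: "\<ominus>\<^bsub>free_ring\<^esub> p = - (p :: ('x, 'k::field) free_algebra)"
proof -
  interpret ring "free_ring :: ('x, 'k) free_algebra ring" by (rule ring_free_ring)
  show ?thesis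
    by (rule minus_equality) (simp_all add: free_ring_sel)
qed

lemma free_ring_idealI:
  fixes J :: "('x, 'k::field) free_algebra set"
  assumes "0 \<in> J" "\<And>p q. p \<in> J \<Longrightarrow> q \<in> J \<Longrightarrow> p + q \<in> J"
    "\<And>p q. p \<in> J \<Longrightarrow> q * p \<in> J" "\<And>p q. p \<in> J \<Longrightarrow> p * q \<in> J"
  shows "ideal J free_ring"
proof (rule idealI[OF ring_free_ring])
  interpret ring "free_ring :: ('x, 'k) free_algebra ring" by (rule ring_free_ring)
  have "- p \<in> J" if "p \<in> J" for p
    using assms(3)[OF that, of "- 1"] by simp
  then show "subgroup J (add_monoid (free_ring :: ('x, 'k) free_algebra ring))"
    using assms(1,2)
    by (intro add.subgroupI) (auto simp: free_ring_sel a_inv_def[symmetric] free_ring_a_inv)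
qed (simp_all add: free_ring_sel assms)

lemma relator_ideal_closed:
  fixes S :: "('x, 'k::field) free_algebra set"
  defines "J \<equiv> Idl\<^bsub>free_ring\<^esub> S"
  shows "0 \<in> J" "p \<in> J \<Longrightarrow> q \<in> J \<Longrightarrow> p + q \<in> J" "p \<in> J \<Longrightarrow> q * p \<in> J" "p \<in> J \<Longrightarrow> p * q \<in> J"
    "p \<in> S \<Longrightarrow> p \<in> J"
proof -
  interpret ideal J "free_ring :: ('x, 'k) free_algebra ring"
    unfolding J_def by (rule ideal_relators)
  show "0 \<in> J" "p \<in> J \<Longrightarrow> q \<in> J \<Longrightarrow> p + q \<in> J" "p \<in> J \<Longrightarrow> q * p \<in> J" "p \<in> J \<Longrightarrow> p * q \<in> J"
    using additive_subgroup.zero_closed[OF additive_subgroup_axioms]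
      additive_subgroup.a_closed[OF additive_subgroup_axioms, of p q]
      I_l_closed[of p q] I_r_closed[of p q]
    by (simp_all add: free_ring_sel)
  show "p \<in> S \<Longrightarrow> p \<in> J"
    using ring.genideal_self[OF ring_free_ring, of S] by (auto simp: J_def free_ring_sel)
qed

lemma relator_ideal_least:
  fixes S :: "('x, 'k::field) free_algebra set"
  assumes "p \<in> Idl\<^bsub>free_ring\<^esub> S" "S \<subseteq> J"
    "0 \<in> J" "\<And>p q. p \<in> J \<Longrightarrow> q \<in> J \<Longrightarrow> p + q \<in> J"
    "\<And>p q. p \<in> J \<Longrightarrow> q * p \<in> J" "\<And>p q. p \<in> J \<Longrightarrow> p * q \<in> J"
  shows "p \<in> J"
  using ring.genideal_minimal[OF ring_free_ring free_ring_idealI[of J] assms(2)] assms by blast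

text \<open>
  The preimage of a two-sided ideal under a homomorphism or an anti-homomorphism is again a two-sided
  ideal, so it suffices to look at the generators of the ideal.
\<close>
lemma relator_ideal_preserved:
  assumes "alg_endo f \<or> alg_anti_endo f" "\<And>r. r \<in> S \<Longrightarrow> f r \<in> Idl\<^bsub>free_ring\<^esub> S"
    and "p \<in> Idl\<^bsub>free_ring\<^esub> S"
  shows "f p \<in> Idl\<^bsub>free_ring\<^esub> S"
proof -
  have add: "f (p + q) = f p + f q" and mult: "f (p * q) = f p * f q \<or> f (p * q) = f q * f p" for p q
    using assms(1) by (auto simp: alg_endo_def alg_anti_endo_def)
  let ?J = "Idl\<^bsub>free_ring\<^esub> S"
  have "f 0 = 0" using add[of 0 0] by simp
  moreover have "f (p * q) \<in> ?J" if "f p \<in> ?J \<or> f q \<in> ?J" for p q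
    using mult[of p q] that relator_ideal_closed(3,4)[where S = S] by metis
  ultimately have "p \<in> {p. f p \<in> ?J}"
    using assms(2) by (intro relator_ideal_least[OF assms(3)]) (auto simp: add relator_ideal_closed)
  then show ?thesis by simp
qed

section \<open>The parameter \<open>t\<close> and the Cartan matrix\<close>

lemma t_indet_eq_Fract: "t_indet = Fract ([:0, 1:] ^ 2) 1"
  by (simp add: t_indet_def t_half_def power2_eq_square)

lemma t_indet_nonzero: "t_indet \<noteq> 0"
  by (simp add: t_indet_eq_Fract Zero_fract_def eq_fract)

lemma t_indet_sq:
  "t_indet * t_indet \<noteq> 1" "t_indet * t_indet + 1 \<noteq> 0"
  by (simp_all add: t_indet_eq_Fract Zero_fract_def One_fract_def eq_fract power2_eq_square one_pCons)

locale simply_laced_cartan =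
  fixes a :: "'i::finite \<Rightarrow> 'i \<Rightarrow> int"
  assumes cartan: "simple_simply_laced_cartan_matrix a"
begin

lemma a_diag [simp]: "a i i = 2"
  using cartan by (simp add: simple_simply_laced_cartan_matrix_def generalized_cartan_matrix_def)

lemma a_cases:
  obtains (same) "i = j" "a i j = 2" | (adjacent) "i \<noteq> j" "a i j = -1" | (apart) "i \<noteq> j" "a i j = 0"
  using cartan a_diag by (auto simp: simple_simply_laced_cartan_matrix_def simply_laced_def)

lemma a_sym: "a i j = a j i"
proof (cases rule: a_cases[of i j])
  case adjacent
  then have "a j i \<noteq> 0"
    using cartan by (metis simple_simply_laced_cartan_matrix_def generalized_cartan_matrix_def zero_neq_neg_one)
  then show ?thesis using adjacent by (cases rule: a_cases[of j i]) auto
next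
  case apart
  then show ?thesis using cartan
    by (simp add: simple_simply_laced_cartan_matrix_def generalized_cartan_matrix_def)
qed simp

text \<open>
  Three mutually adjacent nodes would form the affine diagram \<open>A\<^sub>2\<^sup>(\<^sup>1\<^sup>)\<close>: the quadratic form vanishes on
  the sum of the three simple roots, contradicting positive definiteness.
\<close>
lemma no_triangle:
  assumes "a i j = -1" "a i k = -1" "j \<noteq> k" shows "a j k = 0"
proof (rule ccontr)
  assume "a j k \<noteq> 0"
  then have jk: "a j k = -1" using assms(3) by (cases rule: a_cases[of j k]) auto
  have ne: "i \<noteq> j" "i \<noteq> k" using assms by auto
  note sym = a_sym[of j i] a_sym[of k i] a_sym[of k j]
  obtain d :: "'i \<Rightarrow> real" where d: "\<And>i j. d i * of_int (a i j) = d j * of_int (a j i)"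
    and pos: "\<And>x :: 'i \<Rightarrow> real. \<exists>i. x i \<noteq> 0 \<Longrightarrow>
      (\<Sum>i\<in>UNIV. \<Sum>j\<in>UNIV. d i * of_int (a i j) * x i * x j) > 0"
    using cartan unfolding simple_simply_laced_cartan_matrix_def finite_type_def by blast
  have dd: "d j = d i" "d k = d i"
    using d[of i j] d[of i k] assms sym by simp_all
  define T where "T = {i, j, k}"
  define x :: "'i \<Rightarrow> real" where "x = (\<lambda>l. of_bool (l \<in> T))"
  have "x i \<noteq> 0" by (simp add: x_def T_def)
  then have "0 < (\<Sum>p\<in>UNIV. \<Sum>q\<in>UNIV. d p * of_int (a p q) * x p * x q)" using pos by blast
  also have "\<dots> = (\<Sum>p\<in>UNIV. \<Sum>q\<in>T. d p * of_int (a p q) * x p * x q)"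
    by (intro sum.cong HOL.refl sum.mono_neutral_right) (auto simp: x_def)
  also have "\<dots> = (\<Sum>p\<in>T. \<Sum>q\<in>T. d p * of_int (a p q) * x p * x q)"
    by (intro sum.mono_neutral_right) (auto simp: x_def)
  also have "\<dots> = (\<Sum>p\<in>T. \<Sum>q\<in>T. d p * of_int (a p q))"
    by (intro sum.cong HOL.refl) (auto simp: x_def)
  also have "\<dots> = 0" using ne assms jk sym dd by (simp add: T_def)
  finally show False by simp
qed

abbreviation I where "I \<equiv> Idl\<^bsub>free_ring\<^esub> (Kt_relators a)"

sublocale quantum_congruence
  "free_const :: base_field \<Rightarrow> ('i \<times> int, base_field) free_algebra" I t_half t_indet
  by unfold_locales
    (auto intro: relator_ideal_closed(1-4) free_const_central free_const_simps t_indet_def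
      simp: t_indet_nonzero t_indet_sq)

abbreviation cong_mod_I (infix "\<doteq>" 50) where "p \<doteq> q \<equiv> cong p q"

section \<open>The defining relations as congruences\<close>

lemma Y_commute: "a i j = 0 \<Longrightarrow> Y i m * Y j m \<doteq> Y j m * Y i m"
  unfolding cong_def by (rule relator_ideal_closed(5)) (unfold Kt_relators_def, blast)

lemma Y_serre: "a i j = -1 \<Longrightarrow> serre (Y i m) (Y j m)"
  unfolding serre_def power2_eq_square[symmetric] mult.assoc[of _ "Y i m" "Y i m"]
  by (rule relator_ideal_closed(5)) (unfold Kt_relators_def, blast)

lemma Y_next_level:
  "Y i m * Y j (m + 1) \<doteq>
    free_const (t_indet powi a i j) * (Y j (m + 1) * Y i m) + free_const (of_bool (i = j) * (1 - t_indet ^ 2))"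
  unfolding cong_def by (rule relator_ideal_closed(5)) (unfold Kt_relators_def, blast)

lemma Y_next_level_same:
  "Y i m * Y i (m + 1) \<doteq>
    free_const (t_indet ^ 2) * (Y i (m + 1) * Y i m) + free_const (1 - t_indet ^ 2)"
  using Y_next_level[of i m i] by simp

text \<open>
  With this sign the relations between adjacent levels and those between distant ones have a common
  form, except for the constant that appears at the same node in adjacent levels.
\<close>
definition level_sign :: "int \<Rightarrow> int \<Rightarrow> int" where
  "level_sign m p = (-1) ^ nat (p - m + 1)"

lemma level_sign_simps:
  "level_sign m (m + 1) = 1" "level_sign (m + 1) (p + 1) = level_sign m p"
  "m \<le> p \<Longrightarrow> level_sign m (p + 1) = - level_sign m p"
  "m < p \<Longrightarrow> level_sign (m + 1) p = - level_sign m p"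
proof -
  have "nat (p + 1 - m + 1) = Suc (nat (p - m + 1))" if "m \<le> p" using that by simp
  then show "m \<le> p \<Longrightarrow> level_sign m (p + 1) = - level_sign m p"
    unfolding level_sign_def by simp
  have "nat (p - m + 1) = Suc (nat (p - (m + 1) + 1))" if "m < p" using that by simp
  then show "m < p \<Longrightarrow> level_sign (m + 1) p = - level_sign m p"
    unfolding level_sign_def by simp
qed (simp_all add: level_sign_def)

lemma Y_qcomm:
  assumes "m < p" "j = k \<Longrightarrow> m + 1 < p"
  shows "qcomm (t_indet powi (level_sign m p * a j k)) (Y j m) (Y k p)"
proof (cases "p = m + 1")
  case True
  then have "j \<noteq> k" using assms by auto
  then show ?thesis using True Y_next_level[of j m k]
    by (simp add: qcomm_def level_sign_simps free_const_zero)
next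
  case False
  then have "p > m + 1" using assms by simp
  then show ?thesis unfolding qcomm_def cong_def level_sign_def
    by (intro relator_ideal_closed(5)) (unfold Kt_relators_def, blast)
qed

lemma qcomm_one: "qcomm 1 x y \<longleftrightarrow> x * y \<doteq> y * x"
  by (simp add: qcomm_def free_const_simps)

lemma qcomm_powi_bracket_right:
  assumes "qcomm (t_indet powi e1) x y" "qcomm (t_indet powi e2) x z" "e = e1 + e2"
  shows "qcomm (t_indet powi e) x (bracket y z)"
  using qcomm_bracket_right[OF assms(1,2)] by (simp add: assms(3) power_int_add t_indet_nonzero)

lemma qcomm_powi_bracket_left:
  assumes "qcomm (t_indet powi e1) x z" "qcomm (t_indet powi e2) y z" "e = e1 + e2"
  shows "qcomm (t_indet powi e) (bracket x y) z"
  using qcomm_bracket_left[OF assms(1,2)] by (simp add: assms(3) power_int_add t_indet_nonzero)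

section \<open>The endomorphism \<open>\<sigma>\<^sub>i\<close> respects the relations\<close>

definition braid_image :: "'i \<Rightarrow> 'i \<Rightarrow> int \<Rightarrow> ('i \<times> int, base_field) free_algebra" where
  "braid_image i j m = (if a i j \<noteq> -1 then Y j (m + of_bool (i = j)) else bracket (Y j m) (Y i m))"

lemma braid_image_simps:
  "braid_image i i m = Y i (m + 1)" "a i j = -1 \<Longrightarrow> braid_image i j m = bracket (Y j m) (Y i m)"
  "i \<noteq> j \<Longrightarrow> a i j = 0 \<Longrightarrow> braid_image i j m = Y j m"
  by (simp_all add: braid_image_def)

lemma Y_adjacent_next_level:
  assumes "a i j = -1"
  shows "qcomm (inverse t_indet) (Y j m) (Y i (m + 1))"
proof -
  have "j \<noteq> i" using assms by auto
  then show ?thesis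
    using Y_qcomm[of m "m + 1" j i] assms a_sym[of j i] by (simp add: level_sign_simps power_int_minus)
qed

lemma bracket_Y_inverse:
  assumes "a i j = -1"
  shows "bracket (Y i (m + 1)) (bracket (Y j m) (Y i m)) \<doteq> Y j m"
  by (rule bracket_shift_inverse[OF Y_adjacent_next_level[OF assms] Y_next_level_same])

text \<open>
  The case where \<open>k\<close> is the node \<open>i\<close> follows by exchanging \<open>j\<close> and \<open>k\<close>, so it is left out here.
\<close>
lemma braid_image_commute_neq:
  assumes "a j k = 0" "i \<noteq> k"
  shows "braid_image i j m * braid_image i k m \<doteq> braid_image i k m * braid_image i j m"
proof -
  have jk: "j \<noteq> k" using assms by auto
  show ?thesis
  proof (cases rule: a_cases[of i j])
    case same
    then have "qcomm 1 (Y k m) (Y i (m + 1))"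
      using Y_qcomm[of m "m + 1" k i] assms a_sym[of k j] by (auto simp: level_sign_simps)
    then show ?thesis using same assms by (auto simp: braid_image_simps qcomm_one cong_sym)
  next
    case adjacent
    show ?thesis
    proof (cases rule: a_cases[of i k])
      case same
      then show ?thesis using assms by simp
    next
      case adj: adjacent
      then show ?thesis using adjacent assms
        by (simp add: braid_image_simps brackets_commute Y_commute Y_serre)
    next
      case apart
      have "qcomm (1 * 1) (bracket (Y j m) (Y i m)) (Y k m)"
        using apart assms by (intro qcomm_bracket_left) (simp_all add: qcomm_one Y_commute)
      then show ?thesis using adjacent apart by (simp add: braid_image_simps qcomm_one)
    qed
  next
    case apart
    show ?thesis
    proof (cases rule: a_cases[of i k])
      case same
      then show ?thesis using assms by simp
    next
      case adjacent
      have "qcomm (1 * 1) (Y j m) (bracket (Y k m) (Y i m))"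
        using apart assms a_sym[of i j] by (intro qcomm_bracket_right) (simp_all add: qcomm_one Y_commute)
      then show ?thesis using adjacent apart by (simp add: braid_image_simps qcomm_one)
    next
      case apart': apart
      then show ?thesis using apart assms by (simp add: braid_image_simps Y_commute)
    qed
  qed
qed

lemma braid_image_commute:
  assumes "a j k = 0"
  shows "braid_image i j m * braid_image i k m \<doteq> braid_image i k m * braid_image i j m"
proof (cases "i = k")
  case True
  then have "i \<noteq> j" using assms by auto
  then show ?thesis using braid_image_commute_neq[of k j i m] assms a_sym[of j k] by (simp add: cong_sym)
qed (use assms braid_image_commute_neq in blast)

text \<open>
  If one of the nodes is \<open>i\<close> itself, \<open>bracket_Y_inverse\<close> turns the Serre relation into a \<open>q\<close>-commutation.
  The nodes \<open>j\<close> and \<open>k\<close> cannot both be adjacent to \<open>i\<close>, as there is no triangle.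
\<close>
lemma braid_image_serre:
  assumes jk: "a j k = -1"
  shows "serre (braid_image i j m) (braid_image i k m)"
proof -
  have ne: "j \<noteq> k" and kj: "a k j = -1" using jk a_sym[of j k] by auto
  show ?thesis
  proof (cases rule: a_cases[of i j])
    case same
    show ?thesis
      using serre_of_bracket_left[OF bracket_Y_inverse Y_adjacent_next_level] same jk by (auto simp: braid_image_simps)
  next
    case adjacent
    show ?thesis
    proof (cases rule: a_cases[of i k])
      case same
      have "qcomm t_indet (Y j m) (bracket (Y j m) (Y k m))"
        using jk by (intro serre_qcomm_left Y_serre)
      then have "qcomm (inverse t_indet) (bracket (Y j m) (Y k m)) (Y j m)"
        using qcomm_sym t_indet_nonzero by blast
      then show ?thesis
        using serre_of_bracket_right[OF bracket_Y_inverse[OF kj]] same jk kj by (auto simp: braid_image_simps)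
    next
      case adj: adjacent
      then show ?thesis using adjacent no_triangle[of i j k] ne jk by simp
    next
      case apart
      then show ?thesis using adjacent jk a_sym[of i j]
        by (simp add: braid_image_simps serre_bracket_left Y_commute Y_serre)
    qed
  next
    case apart
    show ?thesis
    proof (cases rule: a_cases[of i k])
      case same
      then show ?thesis using apart kj by simp
    next
      case adjacent
      then show ?thesis using apart jk
        by (simp add: braid_image_simps serre_bracket_right Y_commute Y_serre)
    next
      case apart': apart
      then show ?thesis using apart jk by (simp add: braid_image_simps Y_serre)
    qed
  qed
qed

text \<open>
  Where no constant interferes, the exponent for a bracket is the sum of the exponents for its
  entries, and the claim is the invariance of the Cartan form under the simple reflection at \<open>i\<close>; the
  shift of \<open>y\<^sub>i\<^sub>,\<^sub>m\<close> to level \<open>m + 1\<close> supplies the sign.  The entries of a bracket may however meet \<open>y\<^sub>i\<close> in the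
  same or in an adjacent level; these cases are treated separately.
\<close>
lemma braid_image_qcomm:
  assumes mp: "m < p" "j = k \<Longrightarrow> m + 1 < p"
  shows "qcomm (t_indet powi (level_sign m p * a j k)) (braid_image i j m) (braid_image i k p)"
proof (cases rule: a_cases[of i j])
  case same
  show ?thesis
  proof (cases rule: a_cases[of i k])
    case same': same
    then show ?thesis using same mp Y_qcomm[of "m + 1" "p + 1" i i]
      by (auto simp: braid_image_simps level_sign_simps)
  next
    case adjacent
    note [simp] = same(1)[symmetric] adjacent braid_image_simps
    \<comment> \<open>The image of \<open>y\<^sub>i\<^sub>,\<^sub>m\<close> lies one level up, hence meets the bracket in its own level if \<open>p = m + 1\<close> and
      in the adjacent level if \<open>p = m + 2\<close>.\<close>
    consider "p = m + 1" | "p = (m + 1) + 1" | "m + 1 + 1 < p" using mp by linarith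
    then show ?thesis
    proof cases
      case 1
      then show ?thesis using serre_qcomm_right[OF Y_serre[OF adjacent(2)]]
        by (simp add: level_sign_simps power_int_minus)
    next
      case 2
      have "qcomm (inverse t_indet) (Y i (m + 1)) (Y k (m + 1 + 1))"
        using adjacent a_sym[of i k] by (intro Y_adjacent_next_level) simp
      from qcomm_bracket_shift[OF this Y_next_level_same] show ?thesis
        using level_sign_simps(3)[of m "m + 1"] by (simp add: 2 level_sign_simps)
    next
      case 3
      have "qcomm (t_indet powi (level_sign (m + 1) p * a i k)) (Y i (m + 1)) (Y k p)"
        "qcomm (t_indet powi (level_sign (m + 1) p * a i i)) (Y i (m + 1)) (Y i p)"
        by (rule Y_qcomm; use 3 in simp)+
      from qcomm_powi_bracket_right[OF this, of "level_sign m p * a j k"] show ?thesis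
        using mp by (simp add: level_sign_simps)
    qed
  next
    case apart
    have "qcomm 1 (Y i (m + 1)) (Y k p)"
    proof (cases "p = m + 1")
      case True
      then show ?thesis using apart by (simp add: qcomm_one Y_commute)
    next
      case False
      then show ?thesis using Y_qcomm[of "m + 1" p i k] apart mp by auto
    qed
    then show ?thesis using same apart by (auto simp: braid_image_simps)
  qed
next
  case adjacent
  then have ji: "a j i = -1" using a_sym[of i j] by simp
  show ?thesis
  proof (cases rule: a_cases[of i k])
    case same
    have "qcomm (t_indet powi (level_sign m (p + 1) * a j i)) (Y j m) (Y i (p + 1))"
      "qcomm (t_indet powi (level_sign m (p + 1) * a i i)) (Y i m) (Y i (p + 1))"
      by (rule Y_qcomm; use mp in simp)+
    from qcomm_powi_bracket_left[OF this HOL.refl] show ?thesis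
      using mp adjacent same ji by (auto simp: braid_image_simps level_sign_simps)
  next
    case adj: adjacent
    show ?thesis
    proof (cases "p = m + 1")
      case True
      then have "j \<noteq> k" using mp by auto
      then have "a j k = 0" using no_triangle adjacent adj by blast
      moreover have "bracket (Y j m) (Y i m) * bracket (Y k (m + 1)) (Y i (m + 1)) \<doteq>
        free_const 1 * (bracket (Y k (m + 1)) (Y i (m + 1)) * bracket (Y j m) (Y i m)) + free_const 0"
      proof (rule bracket_relation_shift)
        show "Y j m * Y k (m + 1) \<doteq> free_const 1 * (Y k (m + 1) * Y j m) + free_const 0"
          using Y_next_level[of j m k] \<open>a j k = 0\<close> \<open>j \<noteq> k\<close> by simp
        show "qcomm (inverse t_indet) (Y i m) (Y k (m + 1))"
          using adj a_sym[of i k] by (intro Y_adjacent_next_level) simp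
      qed (rule Y_adjacent_next_level[OF adjacent(2)] Y_next_level_same)+
      ultimately show ?thesis using True adjacent adj by (simp add: braid_image_simps qcomm_def free_const_zero)
    next
      case False
      then have far: "m + 1 < p" using mp by simp
      let ?e = "level_sign m p"
      have "qcomm (t_indet powi (?e * a j k + ?e * a j i)) (Y j m) (bracket (Y k p) (Y i p))"
        "qcomm (t_indet powi (?e * a i k + ?e * a i i)) (Y i m) (bracket (Y k p) (Y i p))"
        by (rule qcomm_powi_bracket_right[OF _ _ HOL.refl]; rule Y_qcomm; use far in simp)+
      from qcomm_powi_bracket_left[OF this HOL.refl] show ?thesis
        using adjacent adj ji by (simp add: braid_image_simps)
    qed
  next
    case apart
    have "qcomm (t_indet powi (level_sign m p * a j k)) (Y j m) (Y k p)"
      "qcomm (t_indet powi (level_sign m p * a i k)) (Y i m) (Y k p)"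
      by (rule Y_qcomm; use mp apart in auto)+
    from qcomm_powi_bracket_left[OF this HOL.refl] show ?thesis
      using apart adjacent by (simp add: braid_image_simps)
  qed
next
  case apart
  then have ji: "a j i = 0" using a_sym[of i j] by simp
  show ?thesis
  proof (cases rule: a_cases[of i k])
    case same
    have "qcomm (t_indet powi (level_sign m (p + 1) * a j i)) (Y j m) (Y i (p + 1))"
      by (rule Y_qcomm; use mp in auto)+
    then show ?thesis using same apart ji by (auto simp: braid_image_simps)
  next
    case adjacent
    have "qcomm (t_indet powi (level_sign m p * a j k)) (Y j m) (Y k p)"
      "qcomm (t_indet powi (level_sign m p * a j i)) (Y j m) (Y i p)"
      by (rule Y_qcomm; use mp apart in auto)+
    from qcomm_powi_bracket_right[OF this HOL.refl] show ?thesis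
      using apart adjacent ji by (simp add: braid_image_simps)
  next
    case apart': apart
    then show ?thesis using apart Y_qcomm[OF mp] by (simp add: braid_image_simps)
  qed
qed

lemma braid_image_next_level:
  "braid_image i j m * braid_image i k (m + 1) \<doteq>
    free_const (t_indet powi a j k) * (braid_image i k (m + 1) * braid_image i j m) + free_const (of_bool (j = k) * (1 - t_indet ^ 2))"
proof (cases "j = k")
  case False
  then show ?thesis using braid_image_qcomm[of m "m + 1" j k i]
    by (simp add: level_sign_simps qcomm_def free_const_zero)
next
  case True
  show ?thesis
  proof (cases rule: a_cases[of i j])
    case adjacent
    have "bracket (Y j m) (Y i m) * bracket (Y j (m + 1)) (Y i (m + 1)) \<doteq>
        free_const (t_indet ^ 2) * (bracket (Y j (m + 1)) (Y i (m + 1)) * bracket (Y j m) (Y i m)) +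
        free_const (1 - t_indet ^ 2)"
      by (rule bracket_relation_shift)
        (use adjacent a_sym[of i j] in \<open>simp_all only: Y_adjacent_next_level Y_next_level_same\<close>)
    then show ?thesis using adjacent True by (simp add: braid_image_simps)
  next
    case same
    then show ?thesis using True Y_next_level_same[of k "m + 1"] by (simp add: braid_image_simps)
  next
    case apart
    then show ?thesis using True Y_next_level_same by (simp add: braid_image_simps)
  qed
qed

definition sigma :: "'i \<Rightarrow> ('i \<times> int, base_field) free_algebra \<Rightarrow> ('i \<times> int, base_field) free_algebra" where
  "sigma i = subst_gens (\<lambda>(j, m). braid_image i j m)"

lemma alg_endo_sigma: "alg_endo (sigma i)"
  by (simp add: sigma_def alg_endo_subst_gens)

lemma sigma_Y: "sigma i (Y j m) = braid_image i j m"
  by (simp add: sigma_def Y_def subst_gens_gen)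

lemma sigma_relator:
  assumes "r \<in> Kt_relators a" shows "sigma i r \<in> I"
proof -
  consider j k m where "a j k = 0" "r = Y j m * Y k m - Y k m * Y j m"
    | j k m where "a j k = -1" "r = Y j m ^ 2 * Y k m -
        free_const (t_indet + inverse t_indet) * (Y j m * Y k m * Y j m) + Y k m * Y j m ^ 2"
    | j k m where "r = Y j m * Y k (m + 1) -
        (free_const (t_indet powi a j k) * (Y k (m + 1) * Y j m) + free_const (of_bool (j = k) * (1 - t_indet ^ 2)))"
    | j k m p where "m + 1 < p" "r = Y j m * Y k p -
        free_const (t_indet powi ((-1) ^ nat (p - m + 1) * a j k)) * (Y k p * Y j m)"
    using assms unfolding Kt_relators_def by blast
  then show "sigma i r \<in> I"
  proof cases
    case 1
    then show ?thesis using braid_image_commute[of j k i m]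
      by (simp add: alg_endo_simps[OF alg_endo_sigma] sigma_Y cong_def)
  next
    case 2
    then show ?thesis using braid_image_serre[of j k i m]
      by (simp add: alg_endo_simps[OF alg_endo_sigma] sigma_Y serre_def power2_eq_square mult.assoc)
  next
    case 3
    then show ?thesis using braid_image_next_level[of i j m k]
      by (simp add: alg_endo_simps[OF alg_endo_sigma] sigma_Y cong_def)
  next
    case 4
    then show ?thesis using braid_image_qcomm[of m p j k i]
      by (simp add: alg_endo_simps[OF alg_endo_sigma] sigma_Y qcomm_def cong_def level_sign_def)
  qed
qed

lemma sigma_preserves_I: "p \<in> I \<Longrightarrow> sigma i p \<in> I"
  using relator_ideal_preserved[of "sigma i" "Kt_relators a" p] sigma_relator alg_endo_sigma by blast

section \<open>The inverse of \<open>\<sigma>\<^sub>i\<close>\<close>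

text \<open>
  Reversing products and negating levels preserves the relations, because the Cartan matrix is
  symmetric and only the difference of levels matters.
\<close>
definition flip :: "('i \<times> int, base_field) free_algebra \<Rightarrow> ('i \<times> int, base_field) free_algebra" where
  "flip = subst_gens_rev (\<lambda>(j, m). Y j (- m))"

lemma alg_anti_endo_flip: "alg_anti_endo flip"
  by (simp add: flip_def alg_anti_endo_subst_gens_rev)

lemma flip_Y: "flip (Y j m) = Y j (- m)"
  by (simp add: flip_def Y_def subst_gens_gen)

lemmas flip_simps = alg_anti_endo_simps[OF alg_anti_endo_flip] flip_Y

lemma flip_flip: "flip (flip p) = p"
proof -
  have "alg_endo (flip \<circ> id \<circ> flip)" by (intro alg_endo_conjugate alg_endo_id alg_anti_endo_flip)
  from alg_endo_eqI[OF this alg_endo_id, of p] show ?thesis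
    using flip_Y by (simp add: Y_def split_paired_all)
qed

lemma flip_relator:
  assumes "r \<in> Kt_relators a" shows "flip r \<in> I"
proof -
  consider j k m where "a j k = 0" "r = Y j m * Y k m - Y k m * Y j m"
    | j k m where "a j k = -1" "r = Y j m ^ 2 * Y k m -
        free_const (t_indet + inverse t_indet) * (Y j m * Y k m * Y j m) + Y k m * Y j m ^ 2"
    | j k m where "r = Y j m * Y k (m + 1) -
        (free_const (t_indet powi a j k) * (Y k (m + 1) * Y j m) + free_const (of_bool (j = k) * (1 - t_indet ^ 2)))"
    | j k m p where "m + 1 < p" "r = Y j m * Y k p -
        free_const (t_indet powi ((-1) ^ nat (p - m + 1) * a j k)) * (Y k p * Y j m)"
    using assms unfolding Kt_relators_def by blast
  then show ?thesis
  proof cases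
    case 1
    then show ?thesis using Y_commute[of k j "- m"] a_sym[of j k]
      by (simp add: flip_simps cong_def)
  next
    case 2
    then show ?thesis using Y_serre[of j k "- m"]
      by (simp add: 2(2) flip_simps serre_def power2_eq_square mult.assoc s_right algebra_simps)
  next
    case 3
    then show ?thesis using Y_next_level[of k "- m - 1" j] a_sym[of j k]
      by (simp add: flip_simps cong_def free_const_central[of _ "_ * _", symmetric] eq_commute[of k j])
  next
    case 4
    then show ?thesis using Y_qcomm[of "- p" "- m" k j] a_sym[of j k]
      by (simp add: flip_simps qcomm_def cong_def level_sign_def free_const_central[of _ "_ * _", symmetric])
  qed
qed

lemma flip_preserves_I: "p \<in> I \<Longrightarrow> flip p \<in> I"
  using relator_ideal_preserved[of flip "Kt_relators a" p] flip_relator alg_anti_endo_flip by blast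

definition sigma_inv :: "'i \<Rightarrow> ('i \<times> int, base_field) free_algebra \<Rightarrow> ('i \<times> int, base_field) free_algebra" where
  "sigma_inv i = flip \<circ> sigma i \<circ> flip"

lemma alg_endo_sigma_inv: "alg_endo (sigma_inv i)"
  unfolding sigma_inv_def by (intro alg_endo_conjugate alg_endo_sigma alg_anti_endo_flip)

lemma sigma_inv_preserves_I: "p \<in> I \<Longrightarrow> sigma_inv i p \<in> I"
  by (simp add: sigma_inv_def sigma_preserves_I flip_preserves_I)

lemma alg_endo_bracket: "alg_endo f \<Longrightarrow> f (bracket p q) = bracket (f p) (f q)"
  by (simp add: bracket_def alg_endo_simps)

lemma flip_bracket: "flip (bracket p q) = bracket (flip q) (flip p)"
  by (simp add: bracket_def flip_simps s_central[symmetric])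

lemma sigma_inv_Y:
  "sigma_inv i (Y j m) = (if a i j \<noteq> -1 then Y j (m - of_bool (i = j)) else bracket (Y i m) (Y j m))"
  by (simp add: sigma_inv_def flip_simps sigma_Y braid_image_def flip_bracket)

lemma cong_preserved:
  assumes "alg_endo f" "\<And>p. p \<in> I \<Longrightarrow> f p \<in> I" "p \<doteq> q"
  shows "f p \<doteq> f q"
  using assms(2)[of "p - q"] assms(1,3) by (simp add: cong_def alg_endo_simps)

lemma alg_endo_congI:
  assumes f: "alg_endo f" and g: "alg_endo g" and gen: "\<And>j m. f (Y j m) \<doteq> g (Y j m)"
  shows "f p \<doteq> g p"
proof (induction p rule: free_algebra_induct)
  case (gen x)
  show ?case using assms(3)[of "fst x" "snd x"] by (simp add: Y_def)
qed (simp_all add: alg_endo_simps[OF f] alg_endo_simps[OF g] cong_add cong_mult)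

lemma sigma_sigma_inv: "sigma i (sigma_inv i p) \<doteq> p"
proof -
  have "(sigma i \<circ> sigma_inv i) p \<doteq> id p"
  proof (rule alg_endo_congI[where f = "sigma i \<circ> sigma_inv i" and g = id])
    fix j m
    show "(sigma i \<circ> sigma_inv i) (Y j m) \<doteq> id (Y j m)"
      by (cases rule: a_cases[of i j])
        (simp_all add: sigma_inv_Y sigma_Y braid_image_simps alg_endo_bracket[OF alg_endo_sigma] bracket_Y_inverse)
  qed (intro alg_endo_comp alg_endo_sigma alg_endo_sigma_inv alg_endo_id)+
  then show ?thesis by simp
qed

text \<open>
  The other composite is the conjugate of the first one by \<open>flip\<close>.
\<close>
lemma sigma_inv_sigma: "sigma_inv i (sigma i p) \<doteq> p"
proof -
  have "flip (sigma i (sigma_inv i (flip p)) - flip p) \<in> I"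
    using sigma_sigma_inv[of i "flip p"] by (intro flip_preserves_I) (simp add: cong_def)
  then show ?thesis by (simp add: cong_def sigma_inv_def flip_flip flip_simps)
qed

section \<open>The braid relations\<close>

lemma sigma_sigma_adjacent:
  assumes "a i j = -1" shows "sigma i (sigma j (Y i m)) \<doteq> Y j m"
  using assms a_sym[of i j] bracket_Y_inverse[OF assms, of m]
  by (simp add: sigma_Y braid_image_simps alg_endo_bracket[OF alg_endo_sigma])

lemma sigma_cong: "p \<doteq> q \<Longrightarrow> sigma i p \<doteq> sigma i q"
  by (rule cong_preserved[OF alg_endo_sigma sigma_preserves_I])

text \<open>
  Both sides are computed with \<open>\<sigma>\<^sub>i \<sigma>\<^sub>j y\<^sub>i\<^sub>,\<^sub>m = y\<^sub>j\<^sub>,\<^sub>m\<close>; the left one becomes \<open>[[y\<^sub>k, y\<^sub>i], y\<^sub>j]\<close> and the right one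
  \<open>[y\<^sub>k, [y\<^sub>i, y\<^sub>j]]\<close>.
\<close>
lemma braid_relation_neighbour:
  assumes ij: "a i j = -1" and ik: "a i k = -1" and jk: "a j k = 0" "j \<noteq> k"
  shows "sigma i (sigma j (sigma i (Y k m))) \<doteq> sigma j (sigma i (sigma j (Y k m)))"
proof -
  note br = alg_endo_bracket[OF alg_endo_sigma]
  have ji: "a j i = -1" using ij a_sym by metis
  have "sigma i (sigma j (sigma i (Y k m))) = bracket (bracket (Y k m) (Y i m)) (sigma i (sigma j (Y i m)))"
    using ik jk by (simp add: sigma_Y braid_image_simps br)
  also have "\<dots> \<doteq> bracket (bracket (Y k m) (Y i m)) (Y j m)"
    by (intro cong_bracket cong_refl sigma_sigma_adjacent ij)
  also have "\<dots> \<doteq> bracket (Y k m) (bracket (Y i m) (Y j m))"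
    using jk a_sym[of j k] by (intro bracket_assoc Y_commute) simp
  also have "\<dots> = sigma j (sigma i (sigma j (Y k m)))"
    using ik jk ji by (simp add: sigma_Y braid_image_simps br)
  finally show ?thesis .
qed

lemma braid_relation_end:
  assumes ij: "a i j = -1"
  shows "sigma i (sigma j (sigma i (Y i m))) \<doteq> sigma j (sigma i (sigma j (Y i m)))"
proof -
  have "sigma i (sigma j (sigma i (Y i m))) \<doteq> Y j (m + 1)"
    using sigma_sigma_adjacent[OF ij] by (simp add: sigma_Y braid_image_simps)
  moreover have "sigma j (sigma i (sigma j (Y i m))) \<doteq> Y j (m + 1)"
    using sigma_cong[OF sigma_sigma_adjacent[OF ij], of j m] by (simp add: sigma_Y braid_image_simps)
  ultimately show ?thesis using cong_sym cong_trans by blast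
qed

text \<open>
  By the absence of triangles, a third node is adjacent to at most one of \<open>i\<close> and \<open>j\<close>.
\<close>
lemma sigma_braid:
  assumes ij: "a i j = -1"
  shows "sigma i (sigma j (sigma i p)) \<doteq> sigma j (sigma i (sigma j p))"
proof -
  have ji: "a j i = -1" using ij a_sym by metis
  have "(sigma i \<circ> sigma j \<circ> sigma i) p \<doteq> (sigma j \<circ> sigma i \<circ> sigma j) p"
  proof (rule alg_endo_congI[where f = "sigma i \<circ> sigma j \<circ> sigma i" and g = "sigma j \<circ> sigma i \<circ> sigma j"])
    fix k m
    have "sigma i (sigma j (sigma i (Y k m))) \<doteq> sigma j (sigma i (sigma j (Y k m)))"
    proof (cases rule: a_cases[of i k])
      case same
      then show ?thesis using braid_relation_end[OF ij] by simp
    next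
      case adjacent
      show ?thesis
      proof (cases "j = k")
        case True
        then show ?thesis using braid_relation_end[OF ji] cong_sym by blast
      next
        case False
        then show ?thesis using braid_relation_neighbour ij adjacent no_triangle by blast
      qed
    next
      case apart: apart
      show ?thesis
      proof (cases rule: a_cases[of j k])
        case same
        then show ?thesis using apart ij by simp
      next
        case adjacent
        then show ?thesis using braid_relation_neighbour[OF ji adjacent(2)] apart cong_sym by blast
      next
        case apart': apart
        then show ?thesis using apart by (simp add: sigma_Y braid_image_simps)
      qed
    qed
    then show "(sigma i \<circ> sigma j \<circ> sigma i) (Y k m) \<doteq> (sigma j \<circ> sigma i \<circ> sigma j) (Y k m)" by simp
  qed (intro alg_endo_comp alg_endo_sigma)+
  then show ?thesis by simp
qed

lemma sigma_commute:
  assumes ij: "a i j = 0"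
  shows "sigma i (sigma j p) \<doteq> sigma j (sigma i p)"
proof -
  note br = alg_endo_bracket[OF alg_endo_sigma]
  have ji: "a j i = 0" "i \<noteq> j" using ij a_sym[of i j] by auto
  have "(sigma i \<circ> sigma j) p \<doteq> (sigma j \<circ> sigma i) p"
  proof (rule alg_endo_congI[where f = "sigma i \<circ> sigma j" and g = "sigma j \<circ> sigma i"])
    fix k m
    show "(sigma i \<circ> sigma j) (Y k m) \<doteq> (sigma j \<circ> sigma i) (Y k m)"
    proof (cases rule: a_cases[of i k]; cases rule: a_cases[of j k])
      assume "a i k = -1" "a j k = -1"
      then show ?thesis using ij ji bracket_swap_right[OF Y_commute[OF ij]]
        by (simp add: sigma_Y braid_image_simps br)
    qed (use ij ji in \<open>auto simp: sigma_Y braid_image_simps br\<close>)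
  qed (intro alg_endo_comp alg_endo_sigma)+
  then show ?thesis by simp
qed

section \<open>The action of the braid group on the quotient\<close>

fun act :: "('i \<times> bool) list \<Rightarrow> ('i \<times> int, base_field) free_algebra \<Rightarrow> ('i \<times> int, base_field) free_algebra" where
  "act [] p = p"
| "act ((i, b) # u) p = (if b then sigma i (act u p) else sigma_inv i (act u p))"

lemma act_append: "act (u @ v) p = act u (act v p)"
  by (induction u) auto

lemma alg_endo_act: "alg_endo (act u)"
proof (induction u)
  case Nil
  show ?case by (simp add: alg_endo_def)
next
  case (Cons l u)
  then show ?case using alg_endo_sigma alg_endo_sigma_inv
    by (cases l) (simp add: alg_endo_def)
qed

lemma act_preserves_I: "p \<in> I \<Longrightarrow> act u p \<in> I"
  by (induction u) (auto simp: sigma_preserves_I sigma_inv_preserves_I)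

lemma act_cong: "p \<doteq> q \<Longrightarrow> act u p \<doteq> act u q"
  by (rule cong_preserved[OF alg_endo_act act_preserves_I])

text \<open>
  The equivalence of words is generated by the braid relations and cancellation, so this is what
  makes the action of words descend to the group.
\<close>
lemma act_word_equiv:
  "word_equiv (braid_relations a) u v \<Longrightarrow> act u p \<doteq> act v p"
proof (induction arbitrary: p rule: word_equiv.induct)
  case (relation u v)
  then show ?case by (auto simp: braid_relations_def sigma_braid sigma_commute)
next
  case (cancel x b)
  then show ?case by (simp add: sigma_sigma_inv sigma_inv_sigma)
next
  case (append u u' v v')
  have "act u (act v p) \<doteq> act u (act v' p)" by (intro act_cong append.IH)
  also have "\<dots> \<doteq> act u' (act v' p)" by (rule append.IH)
  finally show ?case by (simp add: act_append)
qed (use cong_sym cong_trans in \<open>blast | simp\<close>)+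

abbreviation coset :: "('i \<times> int, base_field) free_algebra \<Rightarrow> ('i \<times> int, base_field) free_algebra set" where
  "coset p \<equiv> I +>\<^bsub>free_ring\<^esub> p"

lemma mem_coset: "q \<in> coset p \<longleftrightarrow> q \<doteq> p"
proof -
  have "q \<in> coset p \<longleftrightarrow> (\<exists>h\<in>I. q = h + p)" by (auto simp: a_r_coset_def' free_ring_sel)
  also have "\<dots> \<longleftrightarrow> q - p \<in> I" by (metis add_diff_cancel_right' diff_add_cancel)
  finally show ?thesis by (simp add: cong_def)
qed

lemma coset_eq_iff: "coset p = coset q \<longleftrightarrow> p \<doteq> q"
  unfolding set_eq_iff mem_coset using cong_sym cong_trans cong_refl by blast

lemma carrier_Kt: "carrier (Kt a) = range coset"
  by (auto simp: Kt_def presented_algebra_def Let_def FactRing_def A_RCOSETS_def' a_r_coset_def' free_ring_sel)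

lemma coset_ops:
  "coset p \<otimes>\<^bsub>Kt a\<^esub> coset q = coset (p * q)" "coset p \<oplus>\<^bsub>Kt a\<^esub> coset q = coset (p + q)"
  "\<one>\<^bsub>Kt a\<^esub> = coset 1" "\<zero>\<^bsub>Kt a\<^esub> = coset 0" "c \<odot>\<^bsub>Kt a\<^esub> coset p = coset (free_const c * p)"
proof -
  have hom: "coset \<in> ring_hom free_ring (free_ring Quot I)"
    by (rule ideal.rcos_ring_hom[OF ideal_relators])
  note h = ring_hom_mult[OF hom] ring_hom_add[OF hom] ring_hom_one[OF hom]
    ring_hom_zero[OF hom ring_free_ring ideal.quotient_is_ring[OF ideal_relators]]
  show "coset p \<otimes>\<^bsub>Kt a\<^esub> coset q = coset (p * q)" "coset p \<oplus>\<^bsub>Kt a\<^esub> coset q = coset (p + q)"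
    "\<one>\<^bsub>Kt a\<^esub> = coset 1" "\<zero>\<^bsub>Kt a\<^esub> = coset 0" "c \<odot>\<^bsub>Kt a\<^esub> coset p = coset (free_const c * p)"
    using h by (simp_all add: Kt_def presented_algebra_def Let_def free_ring_sel)
qed

lemma coset_minus: "coset p \<ominus>\<^bsub>Kt a\<^esub> coset q = coset (p - q)"
proof -
  interpret ring "Kt a" unfolding Kt_def by (rule ring_presented_algebra)
  have "\<ominus>\<^bsub>Kt a\<^esub> coset q = coset (- q)"
    by (rule minus_equality) (simp_all add: coset_ops carrier_Kt)
  then show ?thesis by (simp add: a_minus_def coset_ops)
qed

lemma coset_bracket:
  "inverse (t_indet - inverse t_indet) \<odot>\<^bsub>Kt a\<^esub>
     (t_half \<odot>\<^bsub>Kt a\<^esub> (coset p \<otimes>\<^bsub>Kt a\<^esub> coset q) \<ominus>\<^bsub>Kt a\<^esub>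
      inverse t_half \<odot>\<^bsub>Kt a\<^esub> (coset q \<otimes>\<^bsub>Kt a\<^esub> coset p)) = coset (bracket p q)"
  by (simp add: coset_ops coset_minus bracket_def)

lemma y_gen_eq: "y_gen a j m = coset (Y j m)"
  by (simp add: y_gen_def presented_algebra_gen_def Y_def)

text \<open>
  The image does not depend on the word \<open>u\<close> and the representative \<open>p\<close>, so the union is over copies of one
  coset.  Group actions are by extensional functions, hence the restriction to the carrier.
\<close>
definition braid_action :: "('i \<times> bool) list set \<Rightarrow>
    ('i \<times> int, base_field) free_algebra set \<Rightarrow> ('i \<times> int, base_field) free_algebra set" where
  "braid_action g = (\<lambda>U\<in>carrier (Kt a). \<Union>u\<in>g. \<Union>p\<in>U. coset (act u p))"

lemma braid_action_coset:
  "braid_action (word_class (braid_relations a) u) (coset p) = coset (act u p)"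
proof -
  have "coset (act v q) = coset (act u p)" if "v \<in> word_class (braid_relations a) u" "q \<in> coset p" for v q
  proof -
    have "act v q \<doteq> act v p" using that(2) by (intro act_cong) (simp add: mem_coset)
    also have "\<dots> \<doteq> act u p"
      using that(1) act_word_equiv cong_sym by (simp add: word_class_def)
    finally show ?thesis by (simp add: coset_eq_iff)
  qed
  moreover have "u \<in> word_class (braid_relations a) u" "p \<in> coset p"
    by (simp_all add: word_class_def word_equiv.refl mem_coset)
  ultimately have "(\<Union>v\<in>word_class (braid_relations a) u. \<Union>q\<in>coset p. coset (act v q)) = coset (act u p)"
    by blast
  then show ?thesis by (simp add: braid_action_def carrier_Kt)
qed

lemma carrier_braid_group: "carrier (braid_group a) = range (word_class (braid_relations a))"
  by (simp add: braid_group_def presented_group_def)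

lemma braid_action_mult:
  assumes "g \<in> carrier (braid_group a)" "h \<in> carrier (braid_group a)" "U \<in> carrier (Kt a)"
  shows "braid_action (g \<otimes>\<^bsub>braid_group a\<^esub> h) U = braid_action g (braid_action h U)"
proof -
  obtain u v p where "g = word_class (braid_relations a) u" "h = word_class (braid_relations a) v" "U = coset p"
    using assms by (auto simp: carrier_braid_group carrier_Kt)
  then show ?thesis
    by (simp add: braid_group_def presented_group_mult braid_action_coset act_append)
qed

lemma braid_action_one: "U \<in> carrier (Kt a) \<Longrightarrow> braid_action \<one>\<^bsub>braid_group a\<^esub> U = U"
  by (auto simp: carrier_Kt braid_group_def presented_group_def braid_action_coset)

lemma braid_action_closed:
  "g \<in> carrier (braid_group a) \<Longrightarrow> U \<in> carrier (Kt a) \<Longrightarrow> braid_action g U \<in> carrier (Kt a)"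
  by (auto simp: carrier_braid_group carrier_Kt braid_action_coset)

lemma group_braid_group: "group (braid_group a)"
  by (simp add: braid_group_def group_presented_group)

lemma braid_action_bij:
  assumes g: "g \<in> carrier (braid_group a)"
  shows "bij_betw (braid_action g) (carrier (Kt a)) (carrier (Kt a))"
proof -
  interpret group "braid_group a" by (rule group_braid_group)
  let ?h = "inv\<^bsub>braid_group a\<^esub> g"
  have h: "?h \<in> carrier (braid_group a)" using g by simp
  show ?thesis
  proof (rule bij_betw_byWitness[where f' = "braid_action ?h"])
    show "\<forall>U\<in>carrier (Kt a). braid_action ?h (braid_action g U) = U"
      using g h by (simp add: braid_action_mult[symmetric] braid_action_one)
    show "\<forall>U\<in>carrier (Kt a). braid_action g (braid_action ?h U) = U"
      using g h by (simp add: braid_action_mult[symmetric] braid_action_one)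
  qed (use g h braid_action_closed in blast)+
qed

lemma group_action_braid: "group_action (braid_group a) (carrier (Kt a)) braid_action"
proof -
  have ext: "braid_action g \<in> extensional (carrier (Kt a))" for g by (simp add: braid_action_def)
  then have Bij: "braid_action g \<in> Bij (carrier (Kt a))" if "g \<in> carrier (braid_group a)" for g
    using braid_action_bij[OF that] by (simp add: Bij_def)
  have "braid_action \<in> hom (braid_group a) (BijGroup (carrier (Kt a)))"
  proof (rule homI)
    fix g h assume gh: "g \<in> carrier (braid_group a)" "h \<in> carrier (braid_group a)"
    have "braid_action (g \<otimes>\<^bsub>braid_group a\<^esub> h) = compose (carrier (Kt a)) (braid_action g) (braid_action h)"
    proof (rule extensionalityI[OF ext])
      fix U assume "U \<in> carrier (Kt a)"
      then show "braid_action (g \<otimes>\<^bsub>braid_group a\<^esub> h) U = compose (carrier (Kt a)) (braid_action g) (braid_action h) U"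
        using gh by (simp add: braid_action_mult compose_eq)
    qed simp
    then show "braid_action (g \<otimes>\<^bsub>braid_group a\<^esub> h) =
        braid_action g \<otimes>\<^bsub>BijGroup (carrier (Kt a))\<^esub> braid_action h"
      using gh Bij by (simp add: BijGroup_def)
  qed (simp add: BijGroup_def Bij)
  then show ?thesis
    by (simp add: group_action_def group_hom_def group_hom_axioms_def group_braid_group group_BijGroup)
qed

lemma braid_action_automorphism:
  assumes g: "g \<in> carrier (braid_group a)"
  shows "braid_action g \<in> algebra_automorphisms (Kt a)"
proof -
  obtain u where u: "g = word_class (braid_relations a) u" using g by (auto simp: carrier_braid_group)
  note act = alg_endo_simps[OF alg_endo_act]
  have "act u 1 = 1" using act(3)[of u 1] by (simp add: free_const_simps)
  then have "braid_action g \<in> ring_hom (Kt a) (Kt a)"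
    by (intro ring_hom_memI) (auto simp: u carrier_Kt braid_action_coset coset_ops act)
  moreover have "braid_action g (c \<odot>\<^bsub>Kt a\<^esub> U) = c \<odot>\<^bsub>Kt a\<^esub> braid_action g U" if "U \<in> carrier (Kt a)" for c U
    using that by (auto simp: u carrier_Kt braid_action_coset coset_ops act)
  ultimately show ?thesis
    using braid_action_bij[OF g] by (simp add: algebra_automorphisms_def ring_iso_def)
qed

lemma inv_braid_gen: "inv\<^bsub>braid_group a\<^esub> braid_gen a i = word_class (braid_relations a) [(i, False)]"
proof -
  interpret group "braid_group a" by (rule group_braid_group)
  show ?thesis
  proof (rule inv_equality)
    show "word_class (braid_relations a) [(i, False)] \<otimes>\<^bsub>braid_group a\<^esub> braid_gen a i = \<one>\<^bsub>braid_group a\<^esub>"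
      using word_equiv.cancel[of "braid_relations a" i False]
      by (simp add: braid_group_def braid_gen_def presented_group_mult)
        (simp add: presented_group_def word_class_eq_iff)
  qed (simp_all add: carrier_braid_group braid_gen_def)
qed

end

theorem theorem2p3:
  fixes a :: "'i::finite \<Rightarrow> 'i \<Rightarrow> int"
  assumes "simple_simply_laced_cartan_matrix a"
  shows "\<exists>\<phi>. group_action (braid_group a) (carrier (Kt a)) \<phi> \<and>
    (\<forall>g \<in> carrier (braid_group a). \<phi> g \<in> algebra_automorphisms (Kt a)) \<and>
    (\<forall>i j m. \<phi> (braid_gen a i) (y_gen a j m) =
       (if a i j \<noteq> -1 then y_gen a j (m + of_bool (i = j))
        else inverse (t_indet - inverse t_indet) \<odot>\<^bsub>Kt a\<^esub>
          (t_half \<odot>\<^bsub>Kt a\<^esub> (y_gen a j m \<otimes>\<^bsub>Kt a\<^esub> y_gen a i m) \<ominus>\<^bsub>Kt a\<^esub>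
           inverse t_half \<odot>\<^bsub>Kt a\<^esub> (y_gen a i m \<otimes>\<^bsub>Kt a\<^esub> y_gen a j m)))) \<and>
    (\<forall>i j m. \<phi> (inv\<^bsub>braid_group a\<^esub> braid_gen a i) (y_gen a j m) =
       (if a i j \<noteq> -1 then y_gen a j (m - of_bool (i = j))
        else inverse (t_indet - inverse t_indet) \<odot>\<^bsub>Kt a\<^esub>
          (t_half \<odot>\<^bsub>Kt a\<^esub> (y_gen a i m \<otimes>\<^bsub>Kt a\<^esub> y_gen a j m) \<ominus>\<^bsub>Kt a\<^esub>
           inverse t_half \<odot>\<^bsub>Kt a\<^esub> (y_gen a j m \<otimes>\<^bsub>Kt a\<^esub> y_gen a i m))))"
proof -
  interpret simply_laced_cartan a by unfold_locales (rule assms)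
  have "braid_action (braid_gen a i) (y_gen a j m) = coset (braid_image i j m)" for i j m
    by (simp add: braid_gen_def y_gen_eq braid_action_coset sigma_Y)
  moreover have "braid_action (inv\<^bsub>braid_group a\<^esub> braid_gen a i) (y_gen a j m) = coset (sigma_inv i (Y j m))" for i j m
    by (simp add: inv_braid_gen y_gen_eq braid_action_coset)
  ultimately show ?thesis
    using group_action_braid braid_action_automorphism
    by (intro exI[of _ braid_action]) (simp add: y_gen_eq coset_bracket braid_image_def sigma_inv_Y)
qed

end
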